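(* Let $\varphi:\mathbf{R}^n\times[0,T]\to\mathbf{R}$ be a Lebesgue measurable function belonging to $L^1([0,T]\to L_2(\mathbf{R}^n))$, and let $V(x,s)=\int_s^T\varphi[y^{x,s}(t),t]\,dt$. Then for every $s\in[0,T]$ $$\left(\int_{\mathbf{R}^n}|V(x,s)|^2dx\right)^{1/2}\le c(s)\int_s^T dt\left(\int_{\mathbf{R}^n}|\varphi(x,t)|^2dx\right)^{1/2},$$ with $$c(s)=\exp\int_s^T\delta_f(t)\,dt,\qquad \delta_f(t)=\frac12\sup_{x\in\mathbf{R}^n}\left|\sum_{i=1}^n\frac{\partial f_i}{\partial x_i}(x,t)\right| .$$
   Context: Fix $T>0$ and $n\ge 1$. The function $f=(f_1,\dots,f_n):\mathbf{R}^n\times[0,T]\to\mathbf{R}^n$ and its $x$-derivatives up to second order inclusive (which exist for each $t$) are measurable and bounded. For $x\in\mathbf{R}^n$, $s\in[0,T]$, $y^{x,s}(t)$, $t\in[s,T]$, denotes the solution of $\frac{dy}{dt}(t)=f[y(t),t]$ with $y(s)=x$. For each $s$, $V(x,s)$ is understood as defined for almost all $x\in\mathbf{R}^n$. *)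

theory Defs
  imports "HOL-Analysis.Analysis"
begin

definition has_partial :: "'n::finite \<Rightarrow> (real ^ 'n \<Rightarrow> real) \<Rightarrow> real ^ 'n \<Rightarrow> bool" where
  "has_partial j g x \<longleftrightarrow> (\<lambda>h. g (x + h *\<^sub>R axis j 1)) field_differentiable (at 0)"

definition partial :: "'n::finite \<Rightarrow> (real ^ 'n \<Rightarrow> real) \<Rightarrow> real ^ 'n \<Rightarrow> real" where
  "partial j g x = deriv (\<lambda>h. g (x + h *\<^sub>R axis j 1)) 0"

definition meas_strip :: "real \<Rightarrow> (real ^ 'n::finite \<Rightarrow> real \<Rightarrow> real) \<Rightarrow> bool" where
  "meas_strip T g \<longleftrightarrow> (\<lambda>(x, t). g x t) \<in> borel_measurable (lebesgue_on (UNIV \<times> {0..T}))"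

definition meas_bdd_strip :: "real \<Rightarrow> (real ^ 'n::finite \<Rightarrow> real \<Rightarrow> real) \<Rightarrow> bool" where
  "meas_bdd_strip T g \<longleftrightarrow>
     meas_strip T g \<and> (\<exists>B. \<forall>x. \<forall>t\<in>{0..T}. \<bar>g x t\<bar> \<le> B)"

text \<open>Only existence of the partial derivatives is required; nothing is assumed about
  regularity in \<open>t\<close> beyond joint measurability.\<close>

definition regular_field :: "real \<Rightarrow> (real ^ 'n::finite \<Rightarrow> real \<Rightarrow> real ^ 'n) \<Rightarrow> bool" where
  "regular_field T f \<longleftrightarrow>
     (\<forall>i. meas_bdd_strip T (\<lambda>x t. f x t $ i)) \<and>
     (\<forall>i j. (\<forall>t\<in>{0..T}. \<forall>x. has_partial j (\<lambda>z. f z t $ i) x) \<and>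
            meas_bdd_strip T (\<lambda>x t. partial j (\<lambda>z. f z t $ i) x)) \<and>
     (\<forall>i j k. (\<forall>t\<in>{0..T}. \<forall>x. has_partial k (partial j (\<lambda>z. f z t $ i)) x) \<and>
              meas_bdd_strip T (\<lambda>x t. partial k (partial j (\<lambda>z. f z t $ i)) x))"

definition abs_continuous_on :: "real set \<Rightarrow> (real \<Rightarrow> 'a::real_normed_vector) \<Rightarrow> bool" where
  "abs_continuous_on S g \<longleftrightarrow>
     (\<forall>\<epsilon>>0. \<exists>\<delta>>0. \<forall>d E. d division_of E \<and> E \<subseteq> S \<and> (\<Sum>k\<in>d. measure lborel k) < \<delta> \<longrightarrow>
        (\<Sum>k\<in>d. norm (g (Sup k) - g (Inf k))) < \<epsilon>)"

text \<open>As \<open>f\<close> is merely measurable in \<open>t\<close>, solutions of \<open>dy/dt = f(y,t)\<close>, \<open>y(s) = x\<close> on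
  \<open>[s,T]\<close> are understood in the sense of Caratheodory.\<close>

definition ode_solution ::
  "(real ^ 'n::finite \<Rightarrow> real \<Rightarrow> real ^ 'n) \<Rightarrow> real \<Rightarrow> real ^ 'n \<Rightarrow> real \<Rightarrow> (real \<Rightarrow> real ^ 'n) \<Rightarrow> bool" where
  "ode_solution f T x s y \<longleftrightarrow>
     y s = x \<and> abs_continuous_on {s..T} y \<and>
     (AE t in lebesgue_on {s..T}. (y has_vector_derivative f (y t) t) (at t within {s..T}))"

definition in_L2 :: "(real ^ 'n::finite \<Rightarrow> real) \<Rightarrow> bool" where
  "in_L2 g \<longleftrightarrow> g \<in> borel_measurable lebesgue \<and> integrable lebesgue (\<lambda>x. \<bar>g x\<bar>\<^sup>2)"

definition L2_norm :: "(real ^ 'n::finite \<Rightarrow> real) \<Rightarrow> real" where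
  "L2_norm g = sqrt (LINT x|lebesgue. \<bar>g x\<bar>\<^sup>2)"

text \<open>\<open>L\<^sup>1([0,T] \<rightarrow> L\<^sub>2)\<close> for jointly measurable functions; joint measurability makes
  \<open>t \<mapsto> \<phi>(\<cdot>,t)\<close> strongly measurable, so it is not listed separately.\<close>

definition in_L1_L2 :: "real \<Rightarrow> (real ^ 'n::finite \<Rightarrow> real \<Rightarrow> real) \<Rightarrow> bool" where
  "in_L1_L2 T \<phi> \<longleftrightarrow>
     meas_strip T \<phi> \<and>
     (AE t in lebesgue_on {0..T}. in_L2 (\<lambda>x. \<phi> x t)) \<and>
     set_integrable lebesgue {0..T} (\<lambda>t. L2_norm (\<lambda>x. \<phi> x t))"

definition path_integral :: "real \<Rightarrow> (real ^ 'n::finite \<Rightarrow> real \<Rightarrow> real) \<Rightarrow>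
    (real ^ 'n \<Rightarrow> real \<Rightarrow> real \<Rightarrow> real ^ 'n) \<Rightarrow> real ^ 'n \<Rightarrow> real \<Rightarrow> real" where
  "path_integral T \<phi> y x s = (LINT t:{s..T}|lebesgue. \<phi> (y x s t) t)"

definition delta :: "(real ^ 'n::finite \<Rightarrow> real \<Rightarrow> real ^ 'n) \<Rightarrow> real \<Rightarrow> real" where
  "delta f t = 1/2 * (SUP x. \<bar>\<Sum>i\<in>UNIV. partial i (\<lambda>z. f z t $ i) x\<bar>)"

definition growth_const :: "real \<Rightarrow> (real ^ 'n::finite \<Rightarrow> real \<Rightarrow> real ^ 'n) \<Rightarrow> real \<Rightarrow> real" where
  "growth_const T f s = exp (LINT t:{s..T}|lebesgue. delta f t)"

end

theory Submission imports Defs begin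

text \<open>
  Write \<open>y\<^sub>t\<close> for the time-\<open>t\<close> flow \<open>x \<mapsto> y x s t\<close> and \<open>c\<close> for \<open>growth_const T f s\<close>. The key fact is that
  the flow compresses Lebesgue measure by at most the factor
  \<open>exp (\<integral>\<^sub>s\<^sup>t 2 \<delta>\<^sub>f) \<le> c\<^sup>2\<close>: the set of \<open>x\<close> with \<open>y\<^sub>t x \<in> S\<close> has measure at most
  \<open>c\<^sup>2\<close> times that of \<open>S\<close> (\<open>emeasure_vimage_flow_le\<close>,
  \<open>emeasure_vimage_flow_le_growth_const\<close>). Hence composing with \<open>y\<^sub>t\<close>
  multiplies the \<open>L\<^sub>2\<close> norm by at most \<open>c\<close>, and Minkowski's integral inequality (\<open>nn_integral_minkowski\<close>)
  applied to \<open>(x, t) \<mapsto> \<phi> (y\<^sub>t x) t\<close> gives the claim (\<open>transported_integral_L2_bound\<close>).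

  The compression bound is proved without differentiating the flow in the initial value. One Euler
  step \<open>x \<mapsto> x + \<integral>\<^sub>a\<^sup>b f(x, \<tau>) d\<tau>\<close> of length \<open>h\<close> is injective for small \<open>h\<close>, and its Jacobian
  determinant is \<open>1 + tr + O(h\<^sup>2)\<close>, where the trace is an integral of the divergence of \<open>f\<close>. So the change of
  variables formula bounds its compression by \<open>exp (\<integral>\<^sub>a\<^sup>b 2 \<delta>\<^sub>f + O(h\<^sup>2))\<close>
  (\<open>emeasure_vimage_euler_le\<close>). The bounds multiply along \<open>N\<close> steps of length
  \<open>(t - s) / N\<close>, with total error \<open>O(1/N)\<close>. The Euler iterates converge pointwise to any Caratheodory
  solution (\<open>euler_iterate_tendsto\<close>), which needs,
  besides the Lipschitz bound, only that an absolutely continuous function is the integral of its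
  almost everywhere derivative (\<open>abs_continuous_on_has_integral\<close>). Fatou's lemma passes the bound to the
  limit for open sets, and outer regularity extends it to Borel sets (\<open>emeasure_vimage_limit_le\<close>).

  The hypotheses on \<open>f\<close> enter through \<open>regular_field_imp_transport_field\<close>: bounded partial derivatives
  of first and second order make \<open>f\<close> Lipschitz in \<open>x\<close> with a uniform second order Taylor bound, and joint
  measurability together with continuity in \<open>x\<close> makes every section \<open>t \<mapsto> f x t\<close> measurable.
\<close>

section \<open>Absolutely continuous functions are integrals of their derivatives\<close>

text \<open>The fundamental theorem of calculus for absolutely continuous functions and the gauge
  integral. Tags outside the exceptional set \<open>N\<close> are handled by the derivative; the intervals tagged in
  \<open>N\<close> lie in an open set of small measure, so absolute continuity makes their increments sum to little.\<close>

lemma abs_continuous_on_has_integral: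
  fixes g :: "real \<Rightarrow> 'a::banach"
  assumes "a \<le> b" and ac: "abs_continuous_on {a..b} g" and N: "negligible N"
    and der: "\<And>t. t \<in> {a..b} - N \<Longrightarrow> (g has_vector_derivative g' t) (at t within {a..b})"
  shows "(g' has_integral (g b - g a)) {a..b}"
proof -
  define g0 where "g0 t = (if t \<in> N then 0 else g' t)" for t
  have "(g0 has_integral (g b - g a)) (cbox a b)"
    unfolding has_integral
  proof (intro allI impI)
    fix e :: real
    assume "e > 0"
    \<comment> \<open>the denominator is kept positive also when \<open>a = b\<close>\<close>
    define e1 where "e1 = e / (2 * (b - a + 1))"
    have e1: "e1 > 0" "e1 * (b - a) < e/2"
      using \<open>e > 0\<close> \<open>a \<le> b\<close> by (auto simp: e1_def field_simps)
    obtain \<eta> where "\<eta> > 0" and \<eta>: "\<And>d E. d division_of E \<Longrightarrow> E \<subseteq> {a..b} \<Longrightarrow>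
        (\<Sum>k\<in>d. measure lborel k) < \<eta> \<Longrightarrow> (\<Sum>k\<in>d. norm (g (Sup k) - g (Inf k))) < e/2"
      using ac \<open>e > 0\<close> unfolding abs_continuous_on_def by (meson half_gt_zero)
    obtain U where "open U" "N \<subseteq> U" and UN: "U - N \<in> lmeasurable" "emeasure lebesgue (U - N) < ennreal \<eta>"
      using sets_lebesgue_outer_open[OF negligible_imp_sets[OF N] \<open>\<eta> > 0\<close>] by metis
    have U: "U \<in> lmeasurable"
      using UN(1) N \<open>N \<subseteq> U\<close> by (metis Un_Diff_cancel2 fmeasurable.Un negligible_iff_measure sup.absorb1)
    have N0: "emeasure lebesgue N = 0"
      using N by (meson negligible_iff_emeasure0 negligible_imp_sets)
    have "emeasure lebesgue U \<le> emeasure lebesgue (U - N) + emeasure lebesgue N"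
      using emeasure_subadditive[of "U - N" lebesgue N] UN(1) N \<open>N \<subseteq> U\<close>
      by (simp add: Un_absorb2 negligible_imp_sets fmeasurableD)
    also have "\<dots> = emeasure lebesgue (U - N)"
      using N0 by simp
    finally have "emeasure lebesgue U < ennreal \<eta>" using UN(2) by simp
    then have mU: "measure lebesgue U < \<eta>"
      using U \<open>\<eta> > 0\<close> by (simp add: emeasure_eq_measure2 ennreal_less_iff)
    have "\<exists>d>0. (t \<in> N \<longrightarrow> ball t d \<subseteq> U) \<and> (t \<in> {a..b} - N \<longrightarrow>
         (\<forall>y\<in>{a..b}. norm (y-t) < d \<longrightarrow> norm (g y - g t - (y-t) *\<^sub>R g' t) \<le> e1 * norm (y-t)))" for t
    proof (cases "t \<in> N")
      case True
      then show ?thesis using \<open>open U\<close> \<open>N \<subseteq> U\<close> by (meson DiffD2 open_contains_ball_eq subsetD)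
    next
      case False
      then show ?thesis
        using der[of t] e1(1) unfolding has_vector_derivative_def has_derivative_within_alt
        by (metis DiffI zero_less_one)
    qed
    then obtain d where d0: "\<And>t. d t > 0" and dN: "\<And>t. t \<in> N \<Longrightarrow> ball t (d t) \<subseteq> U"
      and d: "\<And>t y. t \<in> {a..b} - N \<Longrightarrow> y \<in> {a..b} \<Longrightarrow> norm (y-t) < d t
              \<Longrightarrow> norm (g y - g t - (y-t) *\<^sub>R g' t) \<le> e1 * norm (y-t)"
      by metis
    show "\<exists>\<gamma>. gauge \<gamma> \<and> (\<forall>p. p tagged_division_of cbox a b \<and> \<gamma> fine p \<longrightarrow>
        norm ((\<Sum>(x, k)\<in>p. measure lborel k *\<^sub>R g0 x) - (g b - g a)) < e)"
    proof (intro exI conjI allI impI)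
      show "gauge (\<lambda>x. ball x (d x))"
        using d0 gauge_ball_dependent by blast
    next
      fix p
      assume "p tagged_division_of cbox a b \<and> (\<lambda>x. ball x (d x)) fine p"
      then have ptag: "p tagged_division_of cbox a b" and finep: "(\<lambda>x. ball x (d x)) fine p" by auto
      have fp: "finite p" using ptag by blast
      have ba: "b - a = (\<Sum>(x,K)\<in>p. Sup K - Inf K)" "g b - g a = (\<Sum>(x,K)\<in>p. g(Sup K) - g(Inf K))"
        using additive_tagged_division_1[where f= "\<lambda>x. x"] additive_tagged_division_1[where f=g]
              \<open>a \<le> b\<close> ptag by auto
      \<comment> \<open>\<open>q\<close> collects the intervals tagged in the exceptional set, where the integrand \<open>g0\<close> is \<open>0\<close>\<close>
      define q where "q = {xk \<in> p. fst xk \<in> N}"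
      have qp: "q \<subseteq> p" "finite q" using fp by (auto simp: q_def)
      have qtag: "q tagged_partial_division_of cbox a b"
        using ptag qp(1) tagged_partial_division_subset tagged_division_of_def by blast
      have good: "norm (measure lborel K *\<^sub>R g0 x - (g (Sup K) - g (Inf K))) \<le> e1 * (Sup K - Inf K)"
        if "(x, K) \<in> p - q" for x K
      proof -
        from that have xK: "(x, K) \<in> p" and xN: "x \<notin> N" by (auto simp: q_def)
        have "x \<in> K" and kab: "K \<subseteq> cbox a b"
          using ptag xK by blast+
        then obtain u v where k: "K = cbox u v"
          using ptag xK by auto
        have "u \<le> v" using \<open>x \<in> K\<close> unfolding k by auto
        have ball: "\<forall>y\<in>K. y \<in> ball x (d x)" using finep xK by blast
        have uv: "u \<in> K" "v \<in> K" by (simp_all add: \<open>u \<le> v\<close> k)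
        have xab: "x \<in> {a..b} - N" "u \<in> {a..b}" "v \<in> {a..b}" using \<open>x \<in> K\<close> uv kab xN by auto
        have "norm (u - x) < d x" "norm (v - x) < d x"
          using uv ball by (auto simp: dist_real_def)
        note * = d[OF xab(1,2) this(1)] d[OF xab(1,3) this(2)]
        have "norm ((v - u) *\<^sub>R g' x - (g v - g u)) = norm (g u - g x - (u - x) *\<^sub>R g' x - (g v - g x - (v - x) *\<^sub>R g' x))"
          by (auto simp: algebra_simps)
        also have "\<dots> \<le> norm (g u - g x - (u - x) *\<^sub>R g' x) + norm (g v - g x - (v - x) *\<^sub>R g' x)"
          by (rule norm_triangle_ineq4)
        also have "\<dots> \<le> e1 * norm (u - x) + e1 * norm (v - x)"
          using * by (rule add_mono)
        also have "\<dots> \<le> e1 * (Sup K - Inf K)"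
          using \<open>x \<in> K\<close> by (auto simp: k interval_bounds_real[OF \<open>u \<le> v\<close>] field_simps)
        finally show ?thesis
          using \<open>u \<le> v\<close> xN by (simp add: k g0_def)
      qed
      have "norm (\<Sum>(x,K)\<in>p-q. measure lborel K *\<^sub>R g0 x - (g (Sup K) - g (Inf K)))
          \<le> (\<Sum>(x,K)\<in>p-q. e1 * (Sup K - Inf K))"
        by (rule sum_norm_le) (use good in auto)
      also have "\<dots> \<le> (\<Sum>(x,K)\<in>p. e1 * (Sup K - Inf K))"
      proof (rule sum_mono2[OF fp])
        fix z assume z: "z \<in> p - (p - q)"
        obtain x K where xK: "z = (x, K)" by (cases z)
        with z obtain u v where "K = cbox u v" "x \<in> K" using ptag by blast
        then show "0 \<le> (case z of (x, K) \<Rightarrow> e1 * (Sup K - Inf K))"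
          using e1(1) xK by (cases "u \<le> v") auto
      qed blast
      also have "\<dots> = e1 * (b - a)" unfolding ba by (simp add: sum_distrib_left split_def)
      also have "\<dots> < e/2" by (rule e1)
      finally have A: "norm (\<Sum>(x,K)\<in>p-q. measure lborel K *\<^sub>R g0 x - (g (Sup K) - g (Inf K))) < e/2" .
      have "norm (\<Sum>(x,K)\<in>q. measure lborel K *\<^sub>R g0 x - (g (Sup K) - g (Inf K)))
          \<le> (\<Sum>(x,K)\<in>q. norm (g (Sup K) - g (Inf K)))"
        by (rule sum_norm_le) (auto simp: q_def g0_def norm_minus_commute)
      \<comment> \<open>the division lemma asks for value \<open>0\<close> on degenerate intervals, including the empty one\<close>
      also have "\<dots> = (\<Sum>(x,K)\<in>q. if K = {} then 0 else norm (g (Sup K) - g (Inf K)))"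
        using qtag by (intro sum.cong) (auto simp: tagged_partial_division_of_def, blast)
      also have "\<dots> = (\<Sum>K\<in>snd ` q. if K = {} then 0 else norm (g (Sup K) - g (Inf K)))"
      proof (rule sum.over_tagged_division_lemma[of q "\<Union>(snd ` q)"])
        show "q tagged_division_of \<Union>(snd ` q)"
          using qtag tagged_partial_division_of_Union_self by blast
        fix u v :: real assume "box u v = {}"
        then have "cbox u v = {} \<or> u = v" by auto
        then show "(if cbox u v = {} then 0 else norm (g (Sup (cbox u v)) - g (Inf (cbox u v)))) = 0"
          by auto
      qed
      also have "\<dots> = (\<Sum>K\<in>snd ` q. norm (g (Sup K) - g (Inf K)))"
        using qtag by (intro sum.cong) (auto simp: tagged_partial_division_of_def, blast)
      also have "\<dots> < e/2"
      proof (rule \<eta>)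
        show div: "snd ` q division_of \<Union>(snd ` q)"
          using qtag partial_division_of_tagged_division by blast
        show "\<Union>(snd ` q) \<subseteq> {a..b}"
          using qtag by (force simp: tagged_partial_division_of_def)
        have "(\<Sum>k\<in>snd ` q. measure lborel k) = (\<Sum>k\<in>snd ` q. measure lebesgue k)"
        proof (rule sum.cong[OF refl])
          fix K assume "K \<in> snd ` q"
          then obtain u v where "K = cbox u v" using division_ofD(4)[OF div] by blast
          then show "measure lborel K = measure lebesgue K" by simp
        qed
        also have "\<dots> = measure lebesgue (\<Union>(snd ` q))"
          by (rule content_division[OF div])
        also have "\<dots> \<le> measure lebesgue U"
        proof (rule measure_mono_fmeasurable[OF _ _ U])
          show "\<Union>(snd ` q) \<subseteq> U"
            using finep dN unfolding fine_def q_def by fastforce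
          show "\<Union>(snd ` q) \<in> sets lebesgue"
            using div lmeasurable_division by blast
        qed
        finally show "(\<Sum>k\<in>snd ` q. measure lborel k) < \<eta>" using mU by simp
      qed
      finally have Bb: "norm (\<Sum>(x,K)\<in>q. measure lborel K *\<^sub>R g0 x - (g (Sup K) - g (Inf K))) < e/2" .
      have "(\<Sum>(x, k)\<in>p. measure lborel k *\<^sub>R g0 x) - (g b - g a)
          = (\<Sum>(x,K)\<in>p. measure lborel K *\<^sub>R g0 x - (g (Sup K) - g (Inf K)))"
        unfolding ba by (simp add: sum_subtractf split_def)
      also have "\<dots> = (\<Sum>(x,K)\<in>p-q. measure lborel K *\<^sub>R g0 x - (g (Sup K) - g (Inf K)))
            + (\<Sum>(x,K)\<in>q. measure lborel K *\<^sub>R g0 x - (g (Sup K) - g (Inf K)))"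
        using sum.subset_diff[OF qp(1) fp] by blast
      finally have eq: "(\<Sum>(x, k)\<in>p. measure lborel k *\<^sub>R g0 x) - (g b - g a) = \<dots>" .
      show "norm ((\<Sum>(x, k)\<in>p. measure lborel k *\<^sub>R g0 x) - (g b - g a)) < e"
        unfolding eq by (rule norm_triangle_lt) (rule add_strict_mono[OF A Bb, unfolded field_sum_of_halves])
    qed
  qed
  then have "(g0 has_integral (g b - g a)) {a..b}" by simp
  then show ?thesis
    by (rule has_integral_spike[OF N, rotated]) (auto simp: g0_def)
qed

section \<open>Well-ordering the coordinates\<close>

text \<open>A copy of a type which, when the type is finite, carries a well-order. The change of
  variables formula on \<open>real ^ 'n\<close> refers to an ordering of the coordinates, and \<open>'a wo\<close> lets it be
  applied with an arbitrary finite index type. The order is that of an arbitrary injection into the naturals.\<close>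

typedef 'a wo = "UNIV :: 'a set" by simp

instance wo :: (finite) finite
proof
  have "(UNIV :: 'a wo set) = range Abs_wo"
    by (metis Rep_wo_inverse surj_def)
  then show "finite (UNIV :: 'a wo set)" by (metis finite finite_imageI)
qed

instantiation wo :: (finite) wellorder
begin
definition less_eq_wo :: "'a wo \<Rightarrow> 'a wo \<Rightarrow> bool" where
  "less_eq_wo x y \<longleftrightarrow> to_nat (Rep_wo x) \<le> to_nat (Rep_wo y)"
definition less_wo :: "'a wo \<Rightarrow> 'a wo \<Rightarrow> bool" where
  "less_wo x y \<longleftrightarrow> to_nat (Rep_wo x) < to_nat (Rep_wo y)"
instance
proof
  fix P :: "'a wo \<Rightarrow> bool" and a
  assume *: "\<And>x. (\<And>y. y < x \<Longrightarrow> P y) \<Longrightarrow> P x"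
  show "P a"
    by (induction a rule: measure_induct_rule[of "\<lambda>x. to_nat (Rep_wo x)"])
      (use * in \<open>auto simp: less_wo_def\<close>)
qed (auto simp: less_eq_wo_def less_wo_def Rep_wo_inject)
end

text \<open>The coordinate relabellings between \<open>real ^ 'n\<close> and \<open>real ^ 'n wo\<close>, inverse to each other.\<close>

definition wo_vec :: "real ^ 'n \<Rightarrow> real ^ 'n wo" where
  "wo_vec x = (\<chi> i. x $ Rep_wo i)"
definition un_wo_vec :: "real ^ 'n wo \<Rightarrow> real ^ 'n" where
  "un_wo_vec x = (\<chi> i. x $ Abs_wo i)"

lemma bij_Rep_wo: "bij Rep_wo"
  by (metis Abs_wo_inverse Rep_wo_inverse UNIV_I bijI')

lemma wo_vec_inverse [simp]: "un_wo_vec (wo_vec x) = x" "wo_vec (un_wo_vec z) = z"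
  by (simp_all add: vec_eq_iff wo_vec_def un_wo_vec_def Rep_wo_inverse Abs_wo_inverse)

lemma wo_vec_nth [simp]: "wo_vec x $ i = x $ Rep_wo i" "un_wo_vec z $ j = z $ Abs_wo j"
  by (simp_all add: wo_vec_def un_wo_vec_def)

lemma bounded_linear_wo_vec: "bounded_linear (wo_vec :: real ^ 'n::finite \<Rightarrow> _)"
   "bounded_linear (un_wo_vec :: _ \<Rightarrow> real ^ 'n::finite)"
proof -
  show "bounded_linear (wo_vec :: real ^ 'n::finite \<Rightarrow> _)"
    by (auto simp: linear_conv_bounded_linear[symmetric] intro!: linearI simp: vec_eq_iff)
  show "bounded_linear (un_wo_vec :: _ \<Rightarrow> real ^ 'n::finite)"
    by (auto simp: linear_conv_bounded_linear[symmetric] intro!: linearI simp: vec_eq_iff)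
qed

lemma distr_un_wo_vec: "distr lborel borel un_wo_vec = (lborel :: (real ^ 'n::finite) measure)"
proof (rule lborel_eqI[symmetric])
  have [measurable]: "(un_wo_vec :: _ \<Rightarrow> real ^ 'n::finite) \<in> borel_measurable borel"
    by (intro borel_measurable_continuous_onI linear_continuous_on bounded_linear_wo_vec)
  fix l u :: "real ^ 'n"
  assume lu: "\<And>b. b \<in> Basis \<Longrightarrow> l \<bullet> b \<le> u \<bullet> b"
  have le: "l $ i \<le> u $ i" for i
    using lu[of "axis i 1"] by (simp add: inner_axis axis_in_Basis_iff)
  have "un_wo_vec -` box l u = box (wo_vec l) (wo_vec u)"
    by (auto simp: mem_box_cart) (metis Abs_wo_inverse Rep_wo_inverse UNIV_I)+
  then have "emeasure (distr lborel borel un_wo_vec) (box l u) = emeasure lborel (box (wo_vec l) (wo_vec u))"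
    by (subst emeasure_distr) auto
  also have "\<dots> = ennreal (measure lborel (cbox (wo_vec l) (wo_vec u)))"
    using emeasure_eq_ennreal_measure[of lborel "cbox (wo_vec l) (wo_vec u)"] emeasure_lborel_cbox_finite[of "wo_vec l" "wo_vec u"]
    by (simp add: emeasure_lborel_box_eq emeasure_lborel_cbox_eq)
  also have "measure lborel (cbox (wo_vec l) (wo_vec u)) = (\<Prod>i\<in>UNIV. u $ Rep_wo i - l $ Rep_wo i)"
    by (subst content_cbox_if_cart) (auto simp: cbox_interval interval_ne_empty_cart le less_eq_vec_def)
  also have "\<dots> = (\<Prod>i\<in>UNIV. u $ i - l $ i)"
    using prod.reindex_bij_betw[OF bij_Rep_wo, of "\<lambda>i. u $ i - l $ i"] by simp
  also have "\<dots> = measure lborel (cbox l u)"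
    by (subst content_cbox_if_cart) (auto simp: cbox_interval interval_ne_empty_cart le less_eq_vec_def)
  also have "\<dots> = (\<Prod>b\<in>Basis. (u - l) \<bullet> b)"
    using lu by (subst content_cbox_cases) (auto simp: inner_diff_left)
  finally show "emeasure (distr lborel borel un_wo_vec) (box l u) = (\<Prod>b\<in>Basis. (u - l) \<bullet> b)" .
qed simp

section \<open>Volume compression by perturbations of the identity\<close>

lemma prod_one_plus_bound:
  fixes a :: "'i \<Rightarrow> real"
  assumes "finite S" "0 \<le> \<epsilon>" "\<epsilon> \<le> 1" and a: "\<And>i. i \<in> S \<Longrightarrow> \<bar>a i\<bar> \<le> \<epsilon>"
  shows "\<bar>(\<Prod>i\<in>S. 1 + a i) - 1 - (\<Sum>i\<in>S. a i)\<bar> \<le> 4 ^ card S * \<epsilon>\<^sup>2"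
  using assms(1) a
proof (induction S)
  case (insert j S)
  define R where "R = (\<Prod>i\<in>S. 1 + a i) - 1 - (\<Sum>i\<in>S. a i)"
  have R: "\<bar>R\<bar> \<le> 4 ^ card S * \<epsilon>\<^sup>2" using insert unfolding R_def by auto
  have aj: "\<bar>a j\<bar> \<le> \<epsilon>" using insert by auto
  have "\<bar>\<Sum>i\<in>S. a i\<bar> \<le> of_nat (card S) * \<epsilon>"
    using insert.prems by (intro order_trans[OF sum_abs] sum_bounded_above) auto
  then have 1: "\<bar>a j * (\<Sum>i\<in>S. a i)\<bar> \<le> \<epsilon> * (of_nat (card S) * \<epsilon>)"
    unfolding abs_mult using aj \<open>0 \<le> \<epsilon>\<close> by (intro mult_mono) auto
  have "card S < 2 ^ card S" by simp
  also have "(2::nat) ^ card S \<le> 4 ^ card S" by (rule power_mono) auto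
  finally have "card S \<le> 4 ^ card S" by simp
  then have "real (card S) \<le> 4 ^ card S"
    by (metis of_nat_le_iff of_nat_numeral of_nat_power)
  then have 2: "\<epsilon> * (of_nat (card S) * \<epsilon>) \<le> 4 ^ card S * \<epsilon>\<^sup>2"
    using mult_right_mono[of "real (card S)" "4 ^ card S" "\<epsilon> * \<epsilon>"] by (simp add: power2_eq_square algebra_simps)
  have 3: "\<bar>a j * R\<bar> \<le> 1 * (4 ^ card S * \<epsilon>\<^sup>2)"
    unfolding abs_mult using aj R \<open>\<epsilon> \<le> 1\<close> by (intro mult_mono) auto
  have "(\<Prod>i\<in>insert j S. 1 + a i) - 1 - (\<Sum>i\<in>insert j S. a i) = R + a j * (\<Sum>i\<in>S. a i) + a j * R"
    using insert by (simp add: R_def algebra_simps)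
  also have "\<bar>\<dots>\<bar> \<le> 4 * (4 ^ card S * \<epsilon>\<^sup>2)"
    using R 1 2 3 zero_le_power2[of \<epsilon>] abs_triangle_ineq[of "R + a j * (\<Sum>i\<in>S. a i)" "a j * R"]
      abs_triangle_ineq[of R "a j * (\<Sum>i\<in>S. a i)"] by linarith
  finally show ?case using insert by simp
qed simp

text \<open>A permutation other than the identity moves at least two indices, so its
  product in the Leibniz formula contains two entries of size \<open>\<epsilon>\<close>; the identity contributes the
  product of the diagonal, which is \<open>1 + tr A\<close> up to \<open>O(\<epsilon>\<^sup>2)\<close>.\<close>

lemma det_id_plus_lower_bound:
  fixes A :: "real ^ 'n::finite ^ 'n"
  assumes "0 \<le> \<epsilon>" "\<epsilon> \<le> 1" and A: "\<And>i j. \<bar>A $ i $ j\<bar> \<le> \<epsilon>"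
  shows "det (mat 1 + A) \<ge> 1 + (\<Sum>i\<in>UNIV. A $ i $ i)
            - (4 ^ CARD('n) + fact CARD('n) * 2 ^ CARD('n)) * \<epsilon>\<^sup>2"
proof -
  define B where "B = mat 1 + A"
  define t where "t p = of_int (sign p) * (\<Prod>i\<in>UNIV. B $ i $ p i)" for p
  have B: "\<bar>B $ i $ j\<bar> \<le> 2" "i \<noteq> j \<Longrightarrow> \<bar>B $ i $ j\<bar> \<le> \<epsilon>" for i j
    using A[of i j] \<open>\<epsilon> \<le> 1\<close> by (auto simp: B_def mat_def)
  let ?P = "{p. p permutes (UNIV :: 'n set)}"
  have off: "\<bar>t p\<bar> \<le> 2 ^ CARD('n) * \<epsilon>\<^sup>2" if p: "p \<in> ?P - {id}" for p
  proof -
    obtain i where i: "p i \<noteq> i" using p by (auto simp: fun_eq_iff)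
    have j: "p (p i) \<noteq> p i" using p i by (metis DiffD1 mem_Collect_eq permutes_inj injD)
    define R where "R = (UNIV :: 'n set) - {i, p i}"
    have U: "UNIV = insert i (insert (p i) R)" by (auto simp: R_def)
    have nR: "i \<notin> insert (p i) R" "p i \<notin> R" using i by (auto simp: R_def)
    have "\<bar>t p\<bar> = (\<Prod>k\<in>UNIV. \<bar>B $ k $ p k\<bar>)"
      by (simp add: t_def abs_mult abs_prod sign_def)
    also have "\<dots> = \<bar>B $ i $ p i\<bar> * (\<bar>B $ p i $ p (p i)\<bar> * (\<Prod>k\<in>R. \<bar>B $ k $ p k\<bar>))"
      using nR by (subst U, subst prod.insert, simp, simp, subst prod.insert) auto
    also have "\<dots> \<le> \<epsilon> * (\<epsilon> * 2 ^ card R)"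
    proof (intro mult_mono)
      have "(\<Prod>k\<in>R. \<bar>B $ k $ p k\<bar>) \<le> (\<Prod>k\<in>R. 2)"
        by (intro prod_mono) (auto simp: B)
      then show "(\<Prod>k\<in>R. \<bar>B $ k $ p k\<bar>) \<le> 2 ^ card R" by simp
    qed (use B i j \<open>0 \<le> \<epsilon>\<close> in \<open>auto intro!: prod_nonneg mult_nonneg_nonneg\<close>)
    also have "\<dots> = 2 ^ card R * \<epsilon>\<^sup>2" by (simp add: power2_eq_square)
    also have "\<dots> \<le> 2 ^ CARD('n) * \<epsilon>\<^sup>2"
      by (intro mult_right_mono power_increasing card_mono) auto
    finally show ?thesis .
  qed
  have fP: "finite ?P" by (rule finite_permutations) simp
  have "\<bar>\<Sum>p\<in>?P - {id}. t p\<bar> \<le> of_nat (card (?P - {id})) * (2 ^ CARD('n) * \<epsilon>\<^sup>2)"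
    using off by (intro order_trans[OF sum_abs] sum_bounded_above) auto
  also have "\<dots> \<le> fact CARD('n) * (2 ^ CARD('n) * \<epsilon>\<^sup>2)"
  proof (rule mult_right_mono)
    have "card (?P - {id}) \<le> card ?P" using fP by (intro card_mono) auto
    also have "\<dots> = fact CARD('n)" by (rule card_permutations) auto
    finally show "real (card (?P - {id})) \<le> fact CARD('n)"
      by (metis of_nat_fact of_nat_le_iff)
  qed simp
  finally have 1: "\<bar>\<Sum>p\<in>?P - {id}. t p\<bar> \<le> fact CARD('n) * 2 ^ CARD('n) * \<epsilon>\<^sup>2" by simp
  have "t id = (\<Prod>i\<in>UNIV. 1 + A $ i $ i)"
    by (simp add: t_def B_def mat_def)
  then have 2: "\<bar>t id - 1 - (\<Sum>i\<in>UNIV. A $ i $ i)\<bar> \<le> 4 ^ CARD('n) * \<epsilon>\<^sup>2"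
    using prod_one_plus_bound[of "UNIV :: 'n set" \<epsilon> "\<lambda>i. A $ i $ i"] assms by simp
  have "det B = (\<Sum>p\<in>?P. t p)" by (simp add: det_def t_def)
  also have "\<dots> = t id + (\<Sum>p\<in>?P - {id}. t p)"
    by (rule sum.remove[OF fP]) (auto simp: permutes_id)
  finally show ?thesis using 1 2 unfolding B_def by (simp add: algebra_simps)
qed

text \<open>An injective differentiable map with Jacobian determinant at least \<open>c\<close> expands volumes
  by at least the factor \<open>c\<close>. The change of variables formula is applied to the bounded pieces of the preimage, whose
  images have finite measure.\<close>

lemma emeasure_vimage_le_det_wo:
  fixes E :: "real ^ 'n::{finite,wellorder} \<Rightarrow> real ^ 'n::_"
  assumes der: "\<And>x. (E has_derivative (\<lambda>h. J x *v h)) (at x)" and inj: "inj E"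
    and c: "c > 0" and det: "\<And>x. det (J x) \<ge> c" and S: "S \<in> sets borel"
  shows "emeasure lborel (E -` S) \<le> ennreal (1/c) * emeasure lborel S"
proof -
  have cont: "continuous_on UNIV E"
    using der by (meson continuous_at_imp_continuous_on has_derivative_continuous)
  then have [measurable]: "E \<in> borel_measurable borel" by (rule borel_measurable_continuous_onI)
  have ES[measurable]: "E -` S \<in> sets borel" using S measurable_sets_borel[of E borel S] by simp
  define B where "B k = E -` S \<inter> ball 0 (real k)" for k :: nat
  have Bb[measurable]: "B k \<in> sets borel" for k unfolding B_def by simp
  have BL: "B k \<in> lmeasurable" for k
    by (rule bounded_set_imp_lmeasurable) (auto simp: B_def)
  have *: "ennreal c * emeasure lborel (B k) \<le> emeasure lborel S" for k
  proof -
    have derw: "(E has_derivative (\<lambda>h. J x *v h)) (at x within B k)" for x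
      using der has_derivative_at_withinI by blast
    have injk: "inj_on E (B k)" using inj by (meson inj_on_subset subset_UNIV)
    have "E ` B k \<subseteq> E ` cball 0 (real k)" by (auto simp: B_def)
    moreover have "bounded (E ` cball 0 (real k))"
      by (intro compact_imp_bounded compact_continuous_image) (auto intro: continuous_on_subset[OF cont])
    ultimately have bdd: "bounded (E ` B k)" by (rule bounded_subset[rotated])
    have "E differentiable_on B k"
      using derw by (auto simp: differentiable_on_def differentiable_def)
    then have "E ` B k \<in> sets lebesgue"
      using BL by (intro differentiable_image_in_sets_lebesgue) auto
    then have img: "E ` B k \<in> lmeasurable" using bdd by (rule bounded_set_imp_lmeasurable[rotated])
    then have int: "(\<lambda>x. \<bar>det (matrix ((*v) (J x)))\<bar>) integrable_on B k"
      using measurable_differentiable_image_eq[OF _ derw injk] BL by auto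
    have "c * measure lebesgue (B k) = integral (B k) (\<lambda>x. c)"
      using lmeasure_integral[OF BL] integral_mult_right[of "B k" c "\<lambda>_. 1"] by simp
    also have "\<dots> \<le> integral (B k) (\<lambda>x. \<bar>det (matrix ((*v) (J x)))\<bar>)"
      using int det integrable_on_const[OF BL]
      by (intro integral_le) (auto intro: order_trans[OF _ abs_ge_self])
    also have "\<dots> = measure lebesgue (E ` B k)"
      using measure_differentiable_image_eq[OF _ derw injk int] BL by auto
    finally have "ennreal (c * measure lebesgue (B k)) \<le> ennreal (measure lebesgue (E ` B k))"
      by (rule ennreal_leI)
    also have "\<dots> = emeasure lebesgue (E ` B k)" using img by (simp add: emeasure_eq_measure2)
    also have "\<dots> \<le> emeasure lebesgue S"
      using S by (intro emeasure_mono) (auto simp: B_def)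
    finally show ?thesis
      using emeasure_eq_measure2[OF BL[of k]] c S by (simp add: ennreal_mult')
  qed
  have UB: "(\<Union>k. B k) = E -` S"
  proof -
    have "\<exists>k. x \<in> ball 0 (real k)" for x :: "real ^ 'n::{finite,wellorder}"
      using reals_Archimedean2[of "norm x"] by auto
    then show ?thesis by (auto simp: B_def)
  qed
  have "emeasure lborel (E -` S) = (SUP k. emeasure lborel (B k))"
    unfolding UB[symmetric]
    by (intro SUP_emeasure_incseq[symmetric]) (auto simp: incseq_def B_def)
  also have "\<dots> \<le> ennreal (1/c) * emeasure lborel S"
  proof (rule SUP_least)
    fix k
    have "emeasure lborel (B k) = ennreal (1/c) * (ennreal c * emeasure lborel (B k))"
      using c by (simp add: mult.assoc[symmetric] ennreal_mult'[symmetric])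
    also have "\<dots> \<le> ennreal (1/c) * emeasure lborel S" by (intro mult_left_mono *) simp
    finally show "emeasure lborel (B k) \<le> ennreal (1/c) * emeasure lborel S" .
  qed
  finally show ?thesis .
qed

text \<open>The same bound for a perturbation of the identity, over any finite index type and in terms of
  the entries of the derivative of the perturbation. The map is conjugated by the relabelling
  to \<open>real ^ 'n wo\<close>, which preserves Lebesgue measure, the sizes of the entries and the trace.\<close>

lemma emeasure_vimage_perturbation_le:
  fixes F :: "real ^ 'n::finite \<Rightarrow> real ^ 'n"
  assumes der: "\<And>x i. ((\<lambda>z. F z $ i) has_derivative (\<lambda>h. \<Sum>j\<in>UNIV. A x i j * h $ j)) (at x)"
    and inj: "inj (\<lambda>x. x + F x)"
    and \<epsilon>: "0 \<le> \<epsilon>" "\<epsilon> \<le> 1" and A: "\<And>x i j. \<bar>A x i j\<bar> \<le> \<epsilon>"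
    and tr: "\<And>x. (\<Sum>i\<in>UNIV. A x i i) \<ge> - d"
    and c: "c > 0" "c \<le> 1 - d - (4 ^ CARD('n) + fact CARD('n) * 2 ^ CARD('n)) * \<epsilon>\<^sup>2"
    and S: "S \<in> sets borel"
  shows "emeasure lborel ((\<lambda>x. x + F x) -` S) \<le> ennreal (1/c) * emeasure lborel S"
proof -
  define E where "E x = x + F x" for x
  define E' where "E' z = wo_vec (E (un_wo_vec z))" for z :: "real ^ 'n wo"
  define AA :: "real ^ 'n wo \<Rightarrow> real ^ 'n wo ^ 'n wo"
    where "AA z = (\<chi> i j. A (un_wo_vec z) (Rep_wo i) (Rep_wo j))" for z
  have bij: "bij_betw Rep_wo (UNIV :: 'n wo set) UNIV" by (rule bij_Rep_wo)
  have card: "CARD('n wo) = CARD('n)" using bij_betw_same_card[OF bij] .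
  have derF: "(F has_derivative (\<lambda>h. \<chi> i. \<Sum>j\<in>UNIV. A x i j * h $ j)) (at x)" for x
    unfolding has_derivative_componentwise_within[of F]
    using der by (auto simp: Basis_vec_def inner_axis)
  have der': "(E' has_derivative (\<lambda>h. (mat 1 + AA z) *v h)) (at z)" for z
  proof -
    have 2: "(E has_derivative (\<lambda>h. h + (\<chi> i. \<Sum>j\<in>UNIV. A x i j * h $ j))) (at x)" for x
      unfolding E_def by (intro has_derivative_add has_derivative_ident derF)
    have 3: "(un_wo_vec has_derivative un_wo_vec) (at z)"
      by (rule bounded_linear_imp_has_derivative[OF bounded_linear_wo_vec(2)])
    have 4: "(wo_vec has_derivative wo_vec) (at (E (un_wo_vec z)))"
      by (rule bounded_linear_imp_has_derivative[OF bounded_linear_wo_vec(1)])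
    have "(E' has_derivative (\<lambda>h. wo_vec (un_wo_vec h +
            (\<chi> i. \<Sum>j\<in>UNIV. A (un_wo_vec z) i j * un_wo_vec h $ j)))) (at z)"
      unfolding E'_def
      by (rule has_derivative_compose[OF has_derivative_compose[OF 3 2] 4])
    also have "(\<lambda>h. wo_vec (un_wo_vec h +
            (\<chi> i. \<Sum>j\<in>UNIV. A (un_wo_vec z) i j * un_wo_vec h $ j))) = (\<lambda>h. (mat 1 + AA z) *v h)"
    proof (intro ext)
      fix h :: "real ^ 'n wo"
      have "(\<Sum>j\<in>UNIV. A (un_wo_vec z) i j * un_wo_vec h $ j)
          = (\<Sum>j\<in>UNIV. A (un_wo_vec z) i (Rep_wo j) * h $ j)" for i
        using sum.reindex_bij_betw[OF bij, of "\<lambda>j. A (un_wo_vec z) i j * un_wo_vec h $ j"]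
        by (simp add: Rep_wo_inverse)
      then show "wo_vec (un_wo_vec h + (\<chi> i. \<Sum>j\<in>UNIV. A (un_wo_vec z) i j * un_wo_vec h $ j))
            = (mat 1 + AA z) *v h"
        by (simp add: vec_eq_iff matrix_vector_mult_add_rdistrib Rep_wo_inverse)
          (simp add: matrix_vector_mult_def AA_def)
    qed
    finally show ?thesis .
  qed
  have inj': "inj E'"
    using inj unfolding E'_def E_def[abs_def, symmetric] inj_def by (metis wo_vec_inverse)
  have det: "det (mat 1 + AA z) \<ge> c" for z
  proof -
    have "(\<Sum>i\<in>UNIV. AA z $ i $ i) = (\<Sum>i\<in>UNIV. A (un_wo_vec z) i i)"
      using sum.reindex_bij_betw[OF bij, of "\<lambda>i. A (un_wo_vec z) i i"] by (simp add: AA_def)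
    then show ?thesis
      using det_id_plus_lower_bound[of \<epsilon> "AA z"] \<epsilon> A tr[of "un_wo_vec z"] c
      by (simp add: card AA_def)
  qed
  have [measurable]: "(un_wo_vec :: _ \<Rightarrow> real ^ 'n::finite) \<in> borel_measurable borel"
    by (intro borel_measurable_continuous_onI linear_continuous_on bounded_linear_wo_vec)
  from derF have "continuous_on UNIV F"
    by (meson continuous_at_imp_continuous_on has_derivative_continuous)
  then have [measurable]: "F \<in> borel_measurable borel"
    by (rule borel_measurable_continuous_onI)
  have [measurable]: "E \<in> borel_measurable borel" unfolding E_def by measurable
  have dS: "emeasure lborel X = emeasure lborel (un_wo_vec -` X)" if "X \<in> sets borel" for X :: "(real ^ 'n) set"
    by (subst distr_un_wo_vec[symmetric]) (use that in \<open>simp add: emeasure_distr\<close>)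
  have ES: "E -` S \<in> sets borel" using S measurable_sets_borel[of E borel S] by simp
  have uS: "un_wo_vec -` S \<in> sets borel" using S measurable_sets_borel[of un_wo_vec borel S] by simp
  have "emeasure lborel (E -` S) = emeasure lborel (E' -` (un_wo_vec -` S))"
    by (subst dS[OF ES]) (simp add: E'_def vimage_def)
  also have "\<dots> \<le> ennreal (1/c) * emeasure lborel (un_wo_vec -` S)"
    by (rule emeasure_vimage_le_det_wo[OF der' inj' c(1) det uS])
  finally show ?thesis using dS[OF S] by (simp add: E_def[abs_def])
qed

section \<open>Functions with bounded partial derivatives\<close>

lemma has_partial_imp_line_derivative:
  assumes "\<And>x. has_partial j g x"
  shows "((\<lambda>h. g (x + h *\<^sub>R axis j 1)) has_field_derivative partial j g (x + u *\<^sub>R axis j 1)) (at u)"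
proof -
  have "((\<lambda>h. g ((x + u *\<^sub>R axis j 1) + h *\<^sub>R axis j 1)) has_field_derivative
          partial j g (x + u *\<^sub>R axis j 1)) (at 0)"
    using assms[of "x + u *\<^sub>R axis j 1"] unfolding has_partial_def partial_def
    by (rule field_differentiable_derivI)
  moreover have "(x + u *\<^sub>R axis j 1) + h *\<^sub>R axis j 1 = x + (h + u) *\<^sub>R axis j 1" for h :: real
    by (simp add: algebra_simps)
  ultimately have "((\<lambda>h. g (x + (h + u) *\<^sub>R axis j 1)) has_field_derivative
          partial j g (x + u *\<^sub>R axis j 1)) (at 0)" by simp
  then show ?thesis
    using DERIV_shift[of "\<lambda>h. g (x + h *\<^sub>R axis j 1)" _ 0 u] by simp
qed

lemma partial_increment_bound:
  assumes g: "\<And>x. has_partial j g x"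
    and C: "\<And>u. \<bar>u\<bar> \<le> \<bar>h\<bar> \<Longrightarrow> \<bar>partial j g (z + u *\<^sub>R axis j 1) - c\<bar> \<le> C"
  shows "\<bar>g (z + h *\<^sub>R axis j 1) - g z - c * h\<bar> \<le> C * \<bar>h\<bar>"
proof -
  let ?G = "\<lambda>u. g (z + u *\<^sub>R axis j 1) - c * u"
  have "norm (?G h - ?G 0) \<le> C * norm (h - 0)"
  proof (rule field_differentiable_bound[where S = "cball 0 \<bar>h\<bar>"])
    fix u :: real assume "u \<in> cball 0 \<bar>h\<bar>"
    then show "norm (partial j g (z + u *\<^sub>R axis j 1) - c) \<le> C" using C by simp
    show "(?G has_field_derivative partial j g (z + u *\<^sub>R axis j 1) - c) (at u within cball 0 \<bar>h\<bar>)"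
      by (rule has_field_derivative_at_within, rule DERIV_diff[OF has_partial_imp_line_derivative[OF g]])
        (auto intro!: derivative_eq_intros)
  qed auto
  then show ?thesis by (simp add: algebra_simps)
qed

text \<open>Change the coordinates one at a time. With \<open>c = 0\<close> this gives a Lipschitz
  bound, and with \<open>c j\<close> the partial derivative at \<open>x\<close> a first order Taylor estimate; no total
  differentiability is needed in advance.\<close>

lemma partials_increment_bound:
  fixes g :: "real ^ 'n::finite \<Rightarrow> real"
  assumes g: "\<And>j x. has_partial j g x"
    and C: "\<And>j k. norm k \<le> norm h \<Longrightarrow> \<bar>partial j g (x + k) - c j\<bar> \<le> C"
  shows "\<bar>g (x + h) - g x - (\<Sum>j\<in>UNIV. c j * h $ j)\<bar> \<le> real CARD('n) * C * norm h"
proof -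
  \<comment> \<open>\<open>r S\<close> is \<open>h\<close> with the coordinates outside \<open>S\<close> set to \<open>0\<close>\<close>
  define r where "r S = (\<chi> j. if j \<in> S then h $ j else 0)" for S
  have "\<bar>g (x + r S) - g x - (\<Sum>j\<in>S. c j * h $ j)\<bar> \<le> real (card S) * C * norm h" for S :: "'n set"
    using finite[of S]
  proof (induction S)
    case empty
    have "r {} = 0" by (simp add: r_def vec_eq_iff)
    then show ?case by simp
  next
    case (insert j S)
    have C0: "0 \<le> C" using C[of 0 j] by (metis abs_ge_zero norm_ge_zero norm_zero order_trans)
    have r: "r (insert j S) = r S + h $ j *\<^sub>R axis j 1"
      using insert.hyps by (auto simp: r_def vec_eq_iff axis_def)
    have "\<bar>g ((x + r S) + h $ j *\<^sub>R axis j 1) - g (x + r S) - c j * h $ j\<bar> \<le> C * \<bar>h $ j\<bar>"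
    proof (rule partial_increment_bound[OF g])
      fix u assume u: "\<bar>u\<bar> \<le> \<bar>h $ j\<bar>"
      have "norm (r S + u *\<^sub>R axis j 1) \<le> norm h"
        by (rule norm_le_componentwise_cart) (use u insert.hyps in \<open>auto simp: r_def axis_def\<close>)
      then show "\<bar>partial j g (x + r S + u *\<^sub>R axis j 1) - c j\<bar> \<le> C"
        using C by (metis add.assoc)
    qed
    also have "\<dots> \<le> C * norm h" using C0 by (intro mult_left_mono component_le_norm_cart)
    finally have 1: "\<bar>g (x + r (insert j S)) - g (x + r S) - c j * h $ j\<bar> \<le> C * norm h"
      by (simp add: r add.assoc)
    have "real (card (insert j S)) * C * norm h = real (card S) * C * norm h + C * norm h"
      using insert.hyps by (simp add: algebra_simps)
    then show ?case using 1 insert.IH insert.hyps by simp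
  qed
  from this[of UNIV] show ?thesis by (simp add: r_def)
qed

lemma bounded_partials_imp_lipschitz:
  fixes g :: "real ^ 'n::finite \<Rightarrow> real"
  assumes "\<And>j x. has_partial j g x" and "\<And>j x. \<bar>partial j g x\<bar> \<le> B"
  shows "\<bar>g x - g z\<bar> \<le> real CARD('n) * B * norm (x - z)"
  using partials_increment_bound[OF assms(1), of "x - z" z "\<lambda>_. 0" B] assms(2) by simp

section \<open>Measurability on the strip\<close>

lemma meas_strip_borel_representative:
  fixes g :: "real ^ 'n::finite \<Rightarrow> real \<Rightarrow> real"
  assumes "meas_strip T g"
  shows "\<exists>g' \<in> borel_measurable borel. AE z in lborel.
            (if snd z \<in> {0..T} then g (fst z) (snd z) else 0) = g' z"
proof -
  have "closed ((UNIV :: (real ^ 'n) set) \<times> {0..T})" by (intro closed_Times) auto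
  then have "UNIV \<times> {0..T} \<inter> space lebesgue \<in> sets (lebesgue :: ((real ^ 'n) \<times> real) measure)" by simp
  then have "(\<lambda>z. indicator (UNIV \<times> {0..T}) z *\<^sub>R (case z of (x, t) \<Rightarrow> g x t)) \<in> borel_measurable lebesgue"
    using assms unfolding meas_strip_def by (subst (asm) borel_measurable_restrict_space_iff) auto
  also have "(\<lambda>z. indicator (UNIV \<times> {0..T}) z *\<^sub>R (case z of (x, t) \<Rightarrow> g x t))
     = (\<lambda>z. if snd z \<in> {0..T} then g (fst z) (snd z) else 0)"
    by (auto simp: indicator_def)
  finally show ?thesis using completion_ex_borel_measurable_real by fastforce
qed

lemma AE_lborel_dense:
  fixes x :: "'a::euclidean_space"
  assumes "AE z in lborel. P z" and "e > 0"
  shows "\<exists>z\<in>ball x e. P z"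
proof (rule ccontr)
  assume "\<not> (\<exists>z\<in>ball x e. P z)"
  then have sub: "ball x e \<subseteq> {z. \<not> P z}" by auto
  have "AE z in lebesgue. P z" using AE_completion[OF assms(1)] .
  then have "{z. \<not> P z} \<in> null_sets lebesgue" by (simp add: completion.AE_iff_null_sets)
  then have "negligible (ball x e)"
    using sub negligible_iff_null_sets negligible_subset by blast
  then show False using open_not_negligible[of "ball x e"] \<open>e > 0\<close> by auto
qed

lemma AE_lborel_pair:
  fixes P :: "'a::euclidean_space \<Rightarrow> 'b::euclidean_space \<Rightarrow> bool"
  assumes "AE z in lborel. P (fst z) (snd z)"
  shows "AE x in lborel. AE t in lborel. P x t"
proof -
  have "AE z in lborel \<Otimes>\<^sub>M lborel. P (fst z) (snd z)" unfolding lborel_prod by (rule assms)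
  from lborel_pair.AE_pair[OF this] show ?thesis by simp
qed

text \<open>By Fubini almost every section is measurable; continuity in \<open>x\<close> makes every section a
  limit of such sections.\<close>

lemma meas_strip_section:
  fixes g :: "real ^ 'n::finite \<Rightarrow> real \<Rightarrow> real"
  assumes g: "meas_strip T g" and cont: "\<And>t. t \<in> {0..T} \<Longrightarrow> continuous_on UNIV (\<lambda>x. g x t)"
  shows "(\<lambda>t. g x t) \<in> borel_measurable (lebesgue_on {0..T})"
proof -
  define G where "G x t = (if t \<in> {0..T} then g x t else 0)" for x t
  obtain g' where g': "g' \<in> borel_measurable borel" "AE z in lborel. G (fst z) (snd z) = g' z"
    using meas_strip_borel_representative[OF g] unfolding G_def by auto
  have "AE x in lborel. AE t in lborel. G x t = g' (x, t)"
    by (rule AE_lborel_pair) (use g'(2) in simp)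
  moreover have "G x \<in> borel_measurable lebesgue" if "AE t in lborel. G x t = g' (x, t)" for x
  proof (rule borel_measurable_AE)
    have "(\<lambda>t. g' (x, t)) \<in> borel_measurable borel"
      by (rule measurable_compose[OF _ g'(1)]) (simp add: borel_prod[symmetric])
    then show "(\<lambda>t. g' (x, t)) \<in> borel_measurable lebesgue"
      by (intro measurable_completion) simp
    show "AE t in lebesgue. g' (x, t) = G x t"
      using AE_completion[OF that] by (rule eventually_mono) simp
  qed
  ultimately have ae: "AE x in lborel. G x \<in> borel_measurable lebesgue" by (auto elim: eventually_mono)
  have "\<exists>z. dist x z < inverse (real (Suc k)) \<and> G z \<in> borel_measurable lebesgue" for k
    using AE_lborel_dense[OF ae, of "inverse (real (Suc k))" x] by auto
  then obtain z where z: "\<And>k. dist x (z k) < inverse (real (Suc k))" "\<And>k. G (z k) \<in> borel_measurable lebesgue"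
    by metis
  have zx: "z \<longlonglongrightarrow> x"
  proof (rule metric_tendsto_imp_tendsto[OF LIMSEQ_inverse_real_of_nat])
    show "\<forall>\<^sub>F k in sequentially. dist (z k) x \<le> dist (inverse (real (Suc k))) 0"
      using z(1) by (auto simp: dist_commute intro!: always_eventually less_imp_le)
  qed
  have "G x \<in> borel_measurable lebesgue"
  proof (rule borel_measurable_LIMSEQ_real[OF _ z(2)])
    fix t
    show "(\<lambda>k. G (z k) t) \<longlonglongrightarrow> G x t"
      using continuous_on_tendsto_compose[OF cont zx, of t] by (auto simp: G_def)
  qed
  moreover have "G x = (\<lambda>t. indicator {0..T} t *\<^sub>R g x t)" by (auto simp: G_def indicator_def)
  ultimately show ?thesis
    by (subst borel_measurable_restrict_space_iff) auto
qed

lemma cSUP_dense: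
  fixes h :: "'a::topological_space \<Rightarrow> real"
  assumes "continuous_on UNIV h" and "closure Q = UNIV" and "bdd_above (range h)"
  shows "(SUP x. h x) = (SUP x\<in>Q. h x)"
proof (rule antisym)
  have Q: "Q \<noteq> {}" using assms(2) by auto
  have bQ: "bdd_above (h ` Q)" using assms(3) by (rule bdd_above_mono) auto
  show "(SUP x\<in>Q. h x) \<le> (SUP x. h x)"
    using Q assms(3) by (intro cSUP_subset_mono) auto
  have "closed {x. h x \<le> (SUP x\<in>Q. h x)}"
    using assms(1) by (intro closed_Collect_le) (auto intro: continuous_intros)
  moreover have "Q \<subseteq> {x. h x \<le> (SUP x\<in>Q. h x)}" using bQ by (auto intro: cSUP_upper)
  ultimately have "closure Q \<subseteq> {x. h x \<le> (SUP x\<in>Q. h x)}" by (rule closure_minimal[rotated])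
  then have "h x \<le> (SUP x\<in>Q. h x)" for x using assms(2) by auto
  then show "(SUP x. h x) \<le> (SUP x\<in>Q. h x)"
    by (intro cSUP_least) auto
qed

lemma uniform_bound_finite:
  fixes g :: "'i::finite \<Rightarrow> 'a \<Rightarrow> real \<Rightarrow> real"
  assumes "\<And>i. \<exists>B. \<forall>x. \<forall>t\<in>A. \<bar>g i x t\<bar> \<le> B"
  shows "\<exists>B\<ge>0. \<forall>i x. \<forall>t\<in>A. \<bar>g i x t\<bar> \<le> B"
proof -
  obtain b where b: "\<And>i x t. t \<in> A \<Longrightarrow> \<bar>g i x t\<bar> \<le> b i" using assms by metis
  have "\<bar>g i x t\<bar> \<le> (\<Sum>i\<in>UNIV. \<bar>b i\<bar>)" if "t \<in> A" for i x t
    using b[OF that, of i x] member_le_sum[of i UNIV "\<lambda>i. \<bar>b i\<bar>"] by force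
  then show ?thesis by (intro exI[of _ "\<Sum>i\<in>UNIV. \<bar>b i\<bar>"]) (auto intro: sum_nonneg)
qed

section \<open>The working hypotheses on the vector field\<close>

text \<open>The consequences of \<open>regular_field\<close> that the proof uses, with a single constant \<open>B\<close>
  for all bounds. In particular \<open>f x\<close> and the partial derivatives are integrable in time for every \<open>x\<close>.\<close>

locale transport_field =
  fixes T :: real and f :: "real ^ 'n::finite \<Rightarrow> real \<Rightarrow> real ^ 'n" and B :: real
  assumes B_ge_1: "1 \<le> B"
    and f_bound: "t \<in> {0..T} \<Longrightarrow> norm (f x t) \<le> B"
    and f_lipschitz: "t \<in> {0..T} \<Longrightarrow> norm (f x t - f z t) \<le> B * norm (x - z)"
    and partial_bound: "t \<in> {0..T} \<Longrightarrow> \<bar>partial j (\<lambda>z. f z t $ i) x\<bar> \<le> B"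
    and f_taylor: "t \<in> {0..T} \<Longrightarrow>
       \<bar>f (x + h) t $ i - f x t $ i - (\<Sum>j\<in>UNIV. partial j (\<lambda>z. f z t $ i) x * h $ j)\<bar> \<le> B * (norm h)\<^sup>2"
    and f_integrable: "f x integrable_on {0..T}"
    and partial_integrable: "(\<lambda>t. partial j (\<lambda>z. f z t $ i) x) integrable_on {0..T}"
    and delta_integrable: "delta f integrable_on {0..T}"
    and delta_bound: "t \<in> {0..T} \<Longrightarrow> 0 \<le> delta f t \<and> delta f t \<le> B"
    and div_bound: "t \<in> {0..T} \<Longrightarrow> \<bar>\<Sum>i\<in>UNIV. partial i (\<lambda>z. f z t $ i) x\<bar> \<le> 2 * delta f t"

lemma regular_field_imp_transport_field:
  fixes f :: "real ^ 'n::finite \<Rightarrow> real \<Rightarrow> real ^ 'n"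
  assumes f: "regular_field T f"
  shows "\<exists>B. transport_field T f B"
proof -
  define n where "n = real CARD('n)"
  have n1: "n \<ge> 1" unfolding n_def by simp
  have par: "\<And>i j x t. t \<in> {0..T} \<Longrightarrow> has_partial j (\<lambda>z. f z t $ i) x"
    and par2: "\<And>i j k x t. t \<in> {0..T} \<Longrightarrow> has_partial k (partial j (\<lambda>z. f z t $ i)) x"
    using f unfolding regular_field_def by blast+
  have meas: "\<And>i. meas_strip T (\<lambda>x t. f x t $ i)"
    "\<And>i j. meas_strip T (\<lambda>x t. partial j (\<lambda>z. f z t $ i) x)"
    using f unfolding regular_field_def meas_bdd_strip_def by blast+
  have "\<And>i. \<exists>B. \<forall>x. \<forall>t\<in>{0..T}. \<bar>f x t $ i\<bar> \<le> B"
    using f unfolding regular_field_def meas_bdd_strip_def by blast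
  from uniform_bound_finite[where g = "\<lambda>i x t. f x t $ i", OF this] obtain B0 where
    B0: "B0 \<ge> 0" "\<And>i x t. t \<in> {0..T} \<Longrightarrow> \<bar>f x t $ i\<bar> \<le> B0" by blast
  have "\<exists>B. \<forall>x. \<forall>t\<in>{0..T}. \<bar>partial (snd p) (\<lambda>z. f z t $ fst p) x\<bar> \<le> B" for p :: "'n \<times> 'n"
    using f unfolding regular_field_def meas_bdd_strip_def by blast
  from uniform_bound_finite[where g = "\<lambda>p x t. partial (snd p) (\<lambda>z. f z t $ fst p) x", OF this] obtain B1 where
    "B1 \<ge> 0" "\<forall>p x. \<forall>t\<in>{0..T}. \<bar>partial (snd (p::'n\<times>'n)) (\<lambda>z. f z t $ fst p) x\<bar> \<le> B1" by blast
  then have B1: "B1 \<ge> 0" "\<And>i j x t. t \<in> {0..T} \<Longrightarrow> \<bar>partial j (\<lambda>z. f z t $ i) x\<bar> \<le> B1" by auto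
  have "\<exists>B. \<forall>x. \<forall>t\<in>{0..T}. \<bar>partial (snd (snd p)) (partial (fst (snd p)) (\<lambda>z. f z t $ fst p)) x\<bar> \<le> B"
    for p :: "'n \<times> 'n \<times> 'n"
    using f unfolding regular_field_def meas_bdd_strip_def by blast
  from uniform_bound_finite[where g = "\<lambda>p x t. partial (snd (snd p)) (partial (fst (snd p)) (\<lambda>z. f z t $ fst p)) x", OF this] obtain B2 where
    "B2 \<ge> 0" "\<forall>p x. \<forall>t\<in>{0..T}. \<bar>partial (snd (snd (p::'n\<times>'n\<times>'n))) (partial (fst (snd p)) (\<lambda>z. f z t $ fst p)) x\<bar> \<le> B2"
    by blast
  then have B2: "B2 \<ge> 0" "\<And>i j k x t. t \<in> {0..T} \<Longrightarrow> \<bar>partial k (partial j (\<lambda>z. f z t $ i)) x\<bar> \<le> B2"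
    by auto
  have lip0: "\<bar>f x t $ i - f z t $ i\<bar> \<le> n * B1 * norm (x - z)" if "t \<in> {0..T}" for x z t i
    unfolding n_def by (rule bounded_partials_imp_lipschitz[of "\<lambda>z. f z t $ i"]) (use par B1 that in auto)
  have lip1: "\<bar>partial j (\<lambda>z. f z t $ i) x - partial j (\<lambda>z. f z t $ i) z\<bar> \<le> n * B2 * norm (x - z)"
    if "t \<in> {0..T}" for x z t i j
    unfolding n_def by (rule bounded_partials_imp_lipschitz) (use par2 B2 that in auto)
  have lip_cont: "continuous_on UNIV g" if "\<And>x z. \<bar>g x - g z\<bar> \<le> L * norm (x - z)" "0 \<le> L"
    for g :: "real ^ 'n \<Rightarrow> real" and L
    by (rule lipschitz_on_continuous_on[of L]) (use that in \<open>auto simp: lipschitz_on_def dist_norm\<close>)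
  have cont0: "continuous_on UNIV (\<lambda>x. f x t $ i)" if "t \<in> {0..T}" for t i
    by (rule lip_cont[OF lip0[OF that]]) (use n1 B1 in auto)
  have cont1: "continuous_on UNIV (\<lambda>x. partial j (\<lambda>z. f z t $ i) x)" if "t \<in> {0..T}" for t i j
    by (rule lip_cont[OF lip1[OF that]]) (use n1 B2 in auto)
  have int_bdd: "g integrable_on {0..T}"
    if "g \<in> borel_measurable (lebesgue_on {0..T})" "\<And>t. t \<in> {0..T} \<Longrightarrow> \<bar>g t\<bar> \<le> C" for g :: "real \<Rightarrow> real" and C
    by (rule measurable_bounded_by_integrable_imp_integrable[where g = "\<lambda>_. C"]) (use that in auto)
  \<comment> \<open>absolute value of the divergence, so that \<open>2 * delta f t\<close> is its supremum over \<open>x\<close>\<close>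
  define dv where "dv x t = \<bar>\<Sum>i\<in>UNIV. partial i (\<lambda>z. f z t $ i) x\<bar>" for x t
  have dv_le: "dv x t \<le> n * B1" if "t \<in> {0..T}" for x t
    unfolding dv_def n_def using B1(2)[OF that] by (intro order_trans[OF sum_abs] sum_bounded_above) auto
  have dv_bdd: "bdd_above (range (\<lambda>x. dv x t))" if "t \<in> {0..T}" for t
    using dv_le[OF that] by (auto intro!: bdd_aboveI)
  have dv_cont: "continuous_on UNIV (\<lambda>x. dv x t)" if "t \<in> {0..T}" for t
    unfolding dv_def by (intro continuous_intros cont1 that)
  have dv_meas: "dv x \<in> borel_measurable (lebesgue_on {0..T})" for x
    unfolding dv_def using meas_strip_section[OF meas(2) cont1] by measurable
  have delta: "delta f t = 1/2 * (SUP x. dv x t)" for t by (simp add: delta_def dv_def)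
  have dv_delta: "dv x t \<le> 2 * delta f t" if "t \<in> {0..T}" for x t
    unfolding delta using cSUP_upper[OF _ dv_bdd[OF that], of x] by simp
  have delta_le: "delta f t \<le> n * B1" if "t \<in> {0..T}" for t
  proof -
    have "(SUP x. dv x t) \<le> n * B1" using dv_le[OF that] by (intro cSUP_least) auto
    moreover have "0 \<le> n * B1" using n1 B1 by simp
    ultimately show ?thesis unfolding delta by linarith
  qed
  have delta_ge: "0 \<le> delta f t" if "t \<in> {0..T}" for t
    using dv_delta[OF that, of 0] by (simp add: dv_def)
  \<comment> \<open>a supremum over a countable dense set is measurable in \<open>t\<close>\<close>
  obtain Q :: "(real ^ 'n) set" where Q: "countable Q" "\<And>X. open X \<Longrightarrow> X \<noteq> {} \<Longrightarrow> \<exists>d\<in>Q. d \<in> X"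
    using countable_dense_exists by blast
  have "closure Q = UNIV"
    unfolding closure_approachable set_eq_iff using Q(2)[OF open_ball]
    by (metis UNIV_I centre_in_ball dist_commute empty_iff mem_ball mem_Collect_eq)
  then have delta_Q: "delta f t = 1/2 * (SUP x\<in>Q. dv x t)" if "t \<in> {0..T}" for t
    unfolding delta using cSUP_dense[OF dv_cont[OF that] _ dv_bdd[OF that]] by simp
  have "(\<lambda>t. 1/2 * (SUP x\<in>Q. dv x t)) \<in> borel_measurable (lebesgue_on {0..T})"
  proof (intro borel_measurable_times borel_measurable_const borel_measurable_cSUP Q(1) dv_meas)
    fix t assume "t \<in> space (lebesgue_on {0..T})"
    then have "t \<in> {0..T}" by simp
    from dv_bdd[OF this] show "bdd_above ((\<lambda>x. dv x t) ` Q)" by (rule bdd_above_mono) auto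
  qed
  then have "delta f \<in> borel_measurable (lebesgue_on {0..T})"
    by (subst measurable_cong[OF delta_Q]) auto
  then have delta_int: "delta f integrable_on {0..T}"
    by (rule int_bdd[where C = "n * B1"]) (use delta_le delta_ge in auto)
  define B where "B = 1 + n * B0 + n * (n * B1) + n * (n * B2) + n * B1"
  have nn: "0 \<le> n * B0" "0 \<le> n * (n * B1)" "0 \<le> n * (n * B2)" "0 \<le> n * B1" "B1 \<le> n * B1"
    using n1 B0 B1 B2 mult_right_mono[of 1 n B1] by auto
  then have Bge: "1 \<le> B" "n * B0 \<le> B" "n * (n * B1) \<le> B" "n * (n * B2) \<le> B" "n * B1 \<le> B" "B1 \<le> B"
    unfolding B_def by linarith+
  have "transport_field T f B"
  proof
    fix x z h :: "real ^ 'n" and i j :: 'n and t :: real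
    show "1 \<le> B" by fact
    assume t: "t \<in> {0..T}"
    have "norm (f x t) \<le> (\<Sum>i\<in>UNIV. \<bar>f x t $ i\<bar>)" by (rule norm_le_l1_cart)
    also have "\<dots> \<le> n * B0" unfolding n_def using B0 t by (intro sum_bounded_above) auto
    finally show "norm (f x t) \<le> B" using Bge by linarith
    have "norm (f x t - f z t) \<le> (\<Sum>i\<in>UNIV. \<bar>(f x t - f z t) $ i\<bar>)" by (rule norm_le_l1_cart)
    also have "\<dots> \<le> n * (n * B1 * norm (x - z))"
      unfolding n_def by (intro sum_bounded_above) (use lip0[OF t] in \<open>auto simp: n_def\<close>)
    also have "\<dots> \<le> B * norm (x - z)" using mult_right_mono[OF Bge(3), of "norm (x - z)"] by (simp add: mult.assoc)
    finally show "norm (f x t - f z t) \<le> B * norm (x - z)" .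
    show "\<bar>partial j (\<lambda>z. f z t $ i) x\<bar> \<le> B" using B1(2)[OF t, of j i x] Bge by linarith
    have "\<bar>f (x + h) t $ i - f x t $ i - (\<Sum>j\<in>UNIV. partial j (\<lambda>z. f z t $ i) x * h $ j)\<bar>
        \<le> real CARD('n) * (n * B2 * norm h) * norm h"
    proof (rule partials_increment_bound[of "\<lambda>z. f z t $ i"])
      fix j and k :: "real ^ 'n" assume "norm k \<le> norm h"
      then have "n * B2 * norm k \<le> n * B2 * norm h" using n1 B2 by (intro mult_left_mono) auto
      then show "\<bar>partial j (\<lambda>z. f z t $ i) (x + k) - partial j (\<lambda>z. f z t $ i) x\<bar> \<le> n * B2 * norm h"
        using lip1[OF t, of j i "x + k" x] by simp
    qed (use par t in auto)
    also have "\<dots> = n * (n * B2) * (norm h)\<^sup>2" by (simp add: n_def power2_eq_square)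
    also have "\<dots> \<le> B * (norm h)\<^sup>2" using Bge by (intro mult_right_mono) auto
    finally show "\<bar>f (x + h) t $ i - f x t $ i - (\<Sum>j\<in>UNIV. partial j (\<lambda>z. f z t $ i) x * h $ j)\<bar> \<le> B * (norm h)\<^sup>2" .
    show "0 \<le> delta f t \<and> delta f t \<le> B" using delta_ge[OF t] delta_le[OF t] Bge by linarith
    show "\<bar>\<Sum>i\<in>UNIV. partial i (\<lambda>z. f z t $ i) x\<bar> \<le> 2 * delta f t" using dv_delta[OF t] by (simp add: dv_def)
  next
    fix x :: "real ^ 'n" and i j :: 'n
    show "delta f integrable_on {0..T}" by (rule delta_int)
    have "(\<lambda>t. f x t $ i) integrable_on {0..T}" for i
      by (rule int_bdd[OF meas_strip_section[OF meas(1) cont0] B0(2)])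
    then show "f x integrable_on {0..T}"
      by (subst integrable_componentwise_iff) (auto simp: Basis_vec_def inner_axis)
    show "(\<lambda>t. partial j (\<lambda>z. f z t $ i) x) integrable_on {0..T}"
      by (rule int_bdd[OF meas_strip_section[OF meas(2) cont1] B1(2)])
  qed
  then show ?thesis by blast
qed

section \<open>Maps of bounded compression\<close>

lemma nn_integral_vimage_le:
  fixes Y :: "'a::euclidean_space \<Rightarrow> 'a"
  assumes [measurable]: "Y \<in> borel_measurable borel" "g \<in> borel_measurable borel"
    and le: "\<And>S. S \<in> sets borel \<Longrightarrow> emeasure lborel (Y -` S) \<le> c * emeasure lborel S"
  shows "(\<integral>\<^sup>+x. g (Y x) \<partial>lborel) \<le> c * (\<integral>\<^sup>+x. g x \<partial>lborel)"
proof -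
  have "(\<integral>\<^sup>+x. g (Y x) \<partial>lborel) = (\<integral>\<^sup>+x. g x \<partial>distr lborel borel Y)"
    by (subst nn_integral_distr) auto
  also have "\<dots> \<le> (\<integral>\<^sup>+x. g x \<partial>scale_measure c lborel)"
  proof (rule nn_integral_mono_measure)
    show "distr lborel borel Y \<le> scale_measure c lborel"
      by (subst le_measure) (auto simp: emeasure_distr le)
  qed simp
  also have "\<dots> = c * (\<integral>\<^sup>+x. g x \<partial>lborel)"
    by (rule nn_integral_scale_measure) simp
  finally show ?thesis .
qed

text \<open>A compression bound passes to pointwise limits. For open \<open>U\<close> the indicator of the limit
  preimage is at most the lower limit of the indicators, so Fatou's lemma applies; outer regularity then gives
  Borel sets.\<close>

lemma emeasure_vimage_limit_le:
  fixes X :: "nat \<Rightarrow> 'a::euclidean_space \<Rightarrow> 'a" and c :: "nat \<Rightarrow> real"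
  assumes X[measurable]: "\<And>N. X N \<in> borel_measurable borel"
    and lim: "\<And>x. (\<lambda>N. X N x) \<longlonglongrightarrow> Y x"
    and le: "\<forall>\<^sub>F N in sequentially. \<forall>S\<in>sets borel. emeasure lborel (X N -` S) \<le> ennreal (c N) * emeasure lborel S"
    and c: "c \<longlonglongrightarrow> C" "C > 0" and S: "S \<in> sets borel"
  shows "emeasure lborel (Y -` S) \<le> ennreal C * emeasure lborel S"
proof -
  have Y[measurable]: "Y \<in> borel_measurable borel"
    by (rule borel_measurable_LIMSEQ_metric[OF X lim])
  have vim[measurable]: "Y -` U \<in> sets borel" "X N -` U \<in> sets borel" if "U \<in> sets borel" for U N
    using that measurable_sets_borel[OF Y that] measurable_sets_borel[OF X that] by simp_all
  have op: "emeasure lborel (Y -` U) \<le> ennreal C * emeasure lborel U" if U: "open U" for U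
  proof (cases "emeasure lborel U = \<infinity>")
    case True
    then show ?thesis using c(2) by (simp add: ennreal_mult_top)
  next
    case False
    then obtain m where m: "emeasure lborel U = ennreal m" "0 \<le> m"
      by (metis ennreal_cases infinity_ennreal_def)
    have Ub[measurable]: "U \<in> sets borel" using U by simp
    have "emeasure lborel (Y -` U) = (\<integral>\<^sup>+x. indicator (Y -` U) x \<partial>lborel)"
      by (rule nn_integral_indicator[symmetric]) simp
    also have "\<dots> \<le> (\<integral>\<^sup>+x. liminf (\<lambda>N. indicator (X N -` U) x) \<partial>lborel)"
    proof (rule nn_integral_mono)
      fix x
      show "indicator (Y -` U) x \<le> liminf (\<lambda>N. indicator (X N -` U) x :: ennreal)"
      proof (cases "Y x \<in> U")
        case True
        have "\<forall>\<^sub>F N in sequentially. X N x \<in> U"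
          using lim[of x] U True by (rule topological_tendstoD)
        then have "\<forall>\<^sub>F N in sequentially. (1::ennreal) \<le> indicator (X N -` U) x"
          by (rule eventually_mono) simp
        then have "1 \<le> liminf (\<lambda>N. indicator (X N -` U) x :: ennreal)"
          by (rule Liminf_bounded)
        then show ?thesis using True by simp
      qed simp
    qed
    also have "\<dots> \<le> liminf (\<lambda>N. \<integral>\<^sup>+x. indicator (X N -` U) x \<partial>lborel)"
      by (rule nn_integral_liminf) simp
    also have "\<dots> = liminf (\<lambda>N. emeasure lborel (X N -` U))"
      by simp
    also have "\<dots> \<le> liminf (\<lambda>N. ennreal (c N * m))"
    proof (rule Liminf_mono)
      have "\<forall>\<^sub>F N in sequentially. c N > 0" using order_tendstoD(1)[OF c] .
      with le show "\<forall>\<^sub>F N in sequentially. emeasure lborel (X N -` U) \<le> ennreal (c N * m)"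
      proof eventually_elim
        case (elim N)
        then have "emeasure lborel (X N -` U) \<le> ennreal (c N) * ennreal m" using Ub m by metis
        then show ?case using elim m by (simp add: ennreal_mult)
      qed
    qed
    also have "\<dots> = ennreal (C * m)"
      by (intro lim_imp_Liminf tendsto_ennrealI tendsto_mult c(1)) auto
    finally show ?thesis using m c(2) by (simp add: ennreal_mult)
  qed
  show ?thesis
  proof (cases "emeasure lborel S = \<infinity>")
    case True
    then show ?thesis using c(2) by (simp add: ennreal_mult_top)
  next
    case False
    then obtain m where m: "emeasure lborel S = ennreal m" "0 \<le> m"
      by (metis ennreal_cases infinity_ennreal_def)
    show ?thesis
    proof (rule ennreal_le_epsilon)
      fix e :: real assume "0 < e"
      \<comment> \<open>the open superset is chosen so that its excess contributes at most \<open>e\<close> after scaling by \<open>C\<close>\<close>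
      then have "0 < e / C" using c(2) by simp
      from outer_regular_lborel[OF S this] obtain U where
        U: "open U" "S \<subseteq> U" "emeasure lborel (U - S) < ennreal (e / C)" .
      have "emeasure lborel (Y -` S) \<le> emeasure lborel (Y -` U)"
        using U S by (intro emeasure_mono) (auto intro!: vim)
      also have "\<dots> \<le> ennreal C * emeasure lborel U" by (rule op[OF U(1)])
      also have "emeasure lborel U = emeasure lborel (S \<union> (U - S))" using U(2) by (simp add: Un_absorb1)
      also have "ennreal C * \<dots> \<le> ennreal C * (emeasure lborel S + ennreal (e / C))"
        using U S by (intro mult_left_mono order_trans[OF emeasure_subadditive] add_left_mono) auto
      also have "\<dots> = ennreal C * emeasure lborel S + ennreal e"
        using c(2) \<open>0 < e\<close> by (simp add: distrib_left ennreal_mult'[symmetric])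
      finally show "emeasure lborel (Y -` S) \<le> ennreal C * emeasure lborel S + ennreal e" .
    qed
  qed
qed

section \<open>One Euler step\<close>

lemma integral_norm_bound_const:
  fixes g :: "real \<Rightarrow> 'b::banach"
  assumes "a \<le> b" "g integrable_on {a..b}" "\<And>t. t \<in> {a..b} \<Longrightarrow> norm (g t) \<le> C"
  shows "norm (integral {a..b} g) \<le> C * (b - a)"
proof -
  have "norm (integral {a..b} g) \<le> integral {a..b} (\<lambda>_. C)"
    by (rule Henstock_Kurzweil_Integration.integral_norm_bound_integral) (use assms in auto)
  then show ?thesis using assms(1) by (simp add: mult.commute)
qed

context transport_field
begin

text \<open>The Euler step from time \<open>a\<close> to \<open>b\<close>. The field is frozen in space but averaged in
  time, since it is only measurable in time.\<close>

definition euler :: "real \<Rightarrow> real \<Rightarrow> real ^ 'n \<Rightarrow> real ^ 'n" where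
  "euler a b x = x + integral {a..b} (f x)"

lemma f_integrable_sub: "0 \<le> a \<Longrightarrow> b \<le> T \<Longrightarrow> f x integrable_on {a..b}"
  by (rule integrable_subinterval_real[OF f_integrable]) auto

lemma partial_integrable_sub:
  "0 \<le> a \<Longrightarrow> b \<le> T \<Longrightarrow> (\<lambda>t. partial j (\<lambda>z. f z t $ i) x) integrable_on {a..b}"
  by (rule integrable_subinterval_real[OF partial_integrable]) auto

lemma delta_integrable_sub: "0 \<le> a \<Longrightarrow> b \<le> T \<Longrightarrow> delta f integrable_on {a..b}"
  by (rule integrable_subinterval_real[OF delta_integrable]) auto

lemma euler_increment_lipschitz:
  assumes "0 \<le> a" "a \<le> b" "b \<le> T"
  shows "norm (integral {a..b} (f x) - integral {a..b} (f z)) \<le> B * (b - a) * norm (x - z)"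
proof -
  have "norm (integral {a..b} (\<lambda>t. f x t - f z t)) \<le> B * norm (x - z) * (b - a)"
    by (rule integral_norm_bound_const)
      (use assms f_integrable_sub f_lipschitz in \<open>auto intro!: integrable_diff\<close>)
  then show ?thesis
    using assms by (subst (asm) integral_diff) (auto simp: f_integrable_sub algebra_simps)
qed

lemma euler_increment_derivative:
  assumes ab: "0 \<le> a" "a \<le> b" "b \<le> T"
  shows "((\<lambda>z. integral {a..b} (f z) $ i) has_derivative
     (\<lambda>h. \<Sum>j\<in>UNIV. integral {a..b} (\<lambda>t. partial j (\<lambda>z. f z t $ i) x) * h $ j)) (at x)"
proof (rule has_derivativeI_sandwich[of 1])
  let ?A = "\<lambda>j. integral {a..b} (\<lambda>t. partial j (\<lambda>z. f z t $ i) x)"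
  show "bounded_linear (\<lambda>h. \<Sum>j\<in>UNIV. ?A j * h $ j)"
    by (intro bounded_linear_sum bounded_linear_const_mult bounded_linear_vec_nth)
  show "((\<lambda>y. B * (b - a) * norm (y - x)) \<longlongrightarrow> 0) (at x)"
    by (auto intro!: tendsto_eq_intros)
  fix y assume "y \<noteq> x"
  define h where "h = y - x"
  let ?D = "\<lambda>t. f y t $ i - f x t $ i - (\<Sum>j\<in>UNIV. partial j (\<lambda>z. f z t $ i) x * h $ j)"
  have fi: "(\<lambda>t. f z t $ i) integrable_on {a..b}" for z
    using integrable_component[OF f_integrable_sub[OF ab(1,3)], of z "axis i 1"] by (simp add: inner_axis)
  have si: "(\<lambda>t. \<Sum>j\<in>UNIV. partial j (\<lambda>z. f z t $ i) x * h $ j) integrable_on {a..b}"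
    by (intro integrable_sum integrable_on_mult_left partial_integrable_sub ab) auto
  have "norm (integral {a..b} ?D) \<le> B * (norm h)\<^sup>2 * (b - a)"
  proof (rule integral_norm_bound_const[OF ab(2)])
    show "?D integrable_on {a..b}" by (intro integrable_diff fi si)
    fix t assume "t \<in> {a..b}"
    then have "t \<in> {0..T}" using ab by auto
    from f_taylor[OF this, of x h i] show "norm (?D t) \<le> B * (norm h)\<^sup>2" by (simp add: h_def)
  qed
  also have "integral {a..b} ?D = integral {a..b} (f y) $ i - integral {a..b} (f x) $ i
        - (\<Sum>j\<in>UNIV. ?A j * h $ j)"
    by (subst integral_diff[OF integrable_diff[OF fi fi] si], subst integral_diff[OF fi fi],
        subst integral_sum)
      (auto intro!: integrable_on_mult_left partial_integrable_sub simp: ab f_integrable_sub)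
  finally have "norm (integral {a..b} (f y) $ i - integral {a..b} (f x) $ i - (\<Sum>j\<in>UNIV. ?A j * h $ j))
      \<le> B * (b - a) * norm h * norm h" by (simp add: power2_eq_square algebra_simps)
  then show "norm (integral {a..b} (f y) $ i - integral {a..b} (f x) $ i - (\<Sum>j\<in>UNIV. ?A j * (y - x) $ j))
        / norm (y - x) \<le> B * (b - a) * norm (y - x)"
    using \<open>y \<noteq> x\<close> by (simp add: h_def divide_le_eq)
qed simp

text \<open>The constant of the quadratic error in \<open>det_id_plus_lower_bound\<close>.\<close>

definition K\<^sub>0 :: real where "K\<^sub>0 = 4 ^ CARD('n) + fact CARD('n) * 2 ^ CARD('n)"

lemma K0_ge_1: "1 \<le> K\<^sub>0"
proof -
  have "(1::real) \<le> 4 ^ CARD('n)" by simp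
  moreover have "(0::real) \<le> fact CARD('n) * 2 ^ CARD('n)" by simp
  ultimately show ?thesis unfolding K\<^sub>0_def by linarith
qed

text \<open>The constant of the quadratic error in the exponent of the compression factor of one Euler step.
  The \<open>18\<close> comes from \<open>ln (1 - u) \<ge> - u - 2 u\<^sup>2\<close> with \<open>u \<le> 3 B h\<close>.\<close>

definition K\<^sub>1 :: real where "K\<^sub>1 = (K\<^sub>0 + 18) * B\<^sup>2"

lemma emeasure_vimage_euler_le:
  assumes ab: "0 \<le> a" "a \<le> b" "b \<le> T" and small: "b - a \<le> 1 / (8 * B * K\<^sub>0)" and S: "S \<in> sets borel"
  shows "emeasure lborel (euler a b -` S)
     \<le> ennreal (exp (integral {a..b} (\<lambda>t. 2 * delta f t) + K\<^sub>1 * (b - a)\<^sup>2)) * emeasure lborel S"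
proof -
  define \<epsilon> where "\<epsilon> = B * (b - a)"
  define d where "d = integral {a..b} (\<lambda>t. 2 * delta f t)"
  \<comment> \<open>\<open>\<epsilon>\<close> bounds the entries and \<open>d\<close> the trace of the derivative of the increment, so the step has Jacobian determinant at least \<open>1 - u\<close>\<close>
  define u where "u = d + K\<^sub>0 * \<epsilon>\<^sup>2"
  have e0: "0 \<le> \<epsilon>" using ab B_ge_1 by (simp add: \<epsilon>_def)
  have "\<epsilon> * K\<^sub>0 \<le> 1 / (8 * B * K\<^sub>0) * (B * K\<^sub>0)"
    using mult_right_mono[OF small, of "B * K\<^sub>0"] K0_ge_1 B_ge_1 by (simp add: \<epsilon>_def algebra_simps)
  also have "\<dots> = 1/8" using K0_ge_1 B_ge_1 by simp
  finally have eK: "\<epsilon> * K\<^sub>0 \<le> 1/8" .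
  have e8: "\<epsilon> \<le> 1/8" using eK K0_ge_1 e0 mult_left_mono[of 1 K\<^sub>0 \<epsilon>] by linarith
  have dint: "(\<lambda>t. 2 * delta f t) integrable_on {a..b}"
    by (intro integrable_on_mult_right delta_integrable_sub ab)
  have d0: "0 \<le> d" unfolding d_def
    by (rule Henstock_Kurzweil_Integration.integral_nonneg[OF dint]) (use delta_bound ab in auto)
  have "norm d \<le> 2 * B * (b - a)" unfolding d_def
    by (rule integral_norm_bound_const[OF ab(2) dint]) (use delta_bound ab in auto)
  then have d2: "d \<le> 2 * \<epsilon>" by (simp add: \<epsilon>_def)
  have Ke: "K\<^sub>0 * \<epsilon>\<^sup>2 \<le> 1/8 * \<epsilon>" using mult_right_mono[OF eK e0] by (simp add: power2_eq_square algebra_simps)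
  have u0: "0 \<le> u" using d0 K0_ge_1 by (simp add: u_def)
  have u3: "u \<le> 3 * \<epsilon>" unfolding u_def using d2 Ke e0 by linarith
  have u2: "u \<le> 1/2" using u3 e8 by linarith
  have "u\<^sup>2 \<le> (3 * \<epsilon>)\<^sup>2" using u3 u0 by (rule power_mono)
  then have uu: "2 * u\<^sup>2 \<le> 18 * \<epsilon>\<^sup>2" by (simp add: power2_eq_square)
  have "- u - 2 * u\<^sup>2 \<le> ln (1 - u)" by (rule ln_one_minus_pos_lower_bound[OF u0 u2])
  then have "exp (- u - 2 * u\<^sup>2) \<le> 1 - u" using u2 by (subst (asm) ln_ge_iff) auto
  moreover have K1: "K\<^sub>1 * (b - a)\<^sup>2 = (K\<^sub>0 + 18) * \<epsilon>\<^sup>2"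
    by (simp only: K\<^sub>1_def \<epsilon>_def power_mult_distrib mult.assoc)
  then have "- (d + K\<^sub>1 * (b - a)\<^sup>2) \<le> - u - 2 * u\<^sup>2" using uu by (simp add: u_def algebra_simps)
  ultimately have c: "exp (- (d + K\<^sub>1 * (b - a)\<^sup>2)) \<le> 1 - d - K\<^sub>0 * \<epsilon>\<^sup>2"
    unfolding u_def by (smt (verit) exp_le_cancel_iff)
  have "emeasure lborel ((\<lambda>x. x + integral {a..b} (f x)) -` S)
     \<le> ennreal (1 / exp (- (d + K\<^sub>1 * (b - a)\<^sup>2))) * emeasure lborel S"
  proof (rule emeasure_vimage_perturbation_le[OF euler_increment_derivative[OF ab] _ e0 _ _ _ exp_gt_zero _ S])
    show "inj (\<lambda>x. x + integral {a..b} (f x))"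
    proof (rule injI)
      fix x z assume eq: "x + integral {a..b} (f x) = z + integral {a..b} (f z)"
      then have "x - z = - (integral {a..b} (f x) - integral {a..b} (f z))" by (simp add: algebra_simps)
      then have "norm (x - z) \<le> \<epsilon> * norm (x - z)"
        using euler_increment_lipschitz[OF ab, of x z] by (metis norm_minus_cancel \<epsilon>_def)
      also have "\<dots> \<le> 1/8 * norm (x - z)" using e8 by (intro mult_right_mono) auto
      finally show "x = z" by simp
    qed
    show "\<epsilon> \<le> 1" using e8 by simp
    show "\<bar>integral {a..b} (\<lambda>t. partial j (\<lambda>z. f z t $ i) x)\<bar> \<le> \<epsilon>" for x i j
      using integral_norm_bound_const[OF ab(2) partial_integrable_sub[OF ab(1,3)], of j i x B] partial_bound ab
      by (simp add: \<epsilon>_def)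
    show "- d \<le> (\<Sum>i\<in>UNIV. integral {a..b} (\<lambda>t. partial i (\<lambda>z. f z t $ i) x))" for x
    proof -
      have "norm (integral {a..b} (\<lambda>t. \<Sum>i\<in>UNIV. partial i (\<lambda>z. f z t $ i) x)) \<le> d"
        unfolding d_def
        by (rule Henstock_Kurzweil_Integration.integral_norm_bound_integral)
          (use dint div_bound ab in \<open>auto intro!: integrable_sum partial_integrable_sub\<close>)
      also have "integral {a..b} (\<lambda>t. \<Sum>i\<in>UNIV. partial i (\<lambda>z. f z t $ i) x)
          = (\<Sum>i\<in>UNIV. integral {a..b} (\<lambda>t. partial i (\<lambda>z. f z t $ i) x))"
        by (rule integral_sum) (use ab in \<open>auto intro!: partial_integrable_sub\<close>)
      finally show ?thesis by simp
    qed
    show "exp (- (d + K\<^sub>1 * (b - a)\<^sup>2)) \<le> 1 - d - (4 ^ CARD('n) + fact CARD('n) * 2 ^ CARD('n)) * \<epsilon>\<^sup>2"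
      using c unfolding K\<^sub>0_def .
  qed
  moreover have "1 / exp (- (d + K\<^sub>1 * (b - a)\<^sup>2)) = exp (d + K\<^sub>1 * (b - a)\<^sup>2)"
    by (subst exp_minus) (simp add: divide_inverse)
  ultimately show ?thesis unfolding d_def euler_def[abs_def] by metis
qed

end

section \<open>Euler iteration and its convergence\<close>

context transport_field
begin

text \<open>The result of \<open>k\<close> Euler steps of length \<open>h\<close> starting at time \<open>s\<close>.\<close>

primrec euler_iterate :: "real \<Rightarrow> real \<Rightarrow> nat \<Rightarrow> real ^ 'n \<Rightarrow> real ^ 'n" where
  "euler_iterate s h 0 x = x"
| "euler_iterate s h (Suc k) x = euler (s + real k * h) (s + real (Suc k) * h) (euler_iterate s h k x)"

lemma euler_measurable:
  assumes "0 \<le> a" "a \<le> b" "b \<le> T"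
  shows "euler a b \<in> borel_measurable borel"
proof -
  have "continuous_on UNIV (\<lambda>x. integral {a..b} (f x))"
    by (rule lipschitz_on_continuous_on[of "B * (b - a)"])
      (use assms B_ge_1 euler_increment_lipschitz[OF assms] in \<open>auto simp: lipschitz_on_def dist_norm\<close>)
  then have "continuous_on UNIV (euler a b)"
    unfolding euler_def by (intro continuous_intros)
  then show ?thesis by (rule borel_measurable_continuous_onI)
qed

lemma euler_iterate_measurable:
  assumes "0 \<le> s" "0 \<le> h" "s + real k * h \<le> T"
  shows "euler_iterate s h k \<in> borel_measurable borel"
  using assms
proof (induction k)
  case 0
  then show ?case by (simp add: measurable_ident_sets)
next
  case (Suc k)
  have "s + real k * h \<le> s + real (Suc k) * h" using Suc.prems by (simp add: algebra_simps)
  then have "euler_iterate s h k \<in> borel_measurable borel"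
    "euler (s + real k * h) (s + real (Suc k) * h) \<in> borel_measurable borel"
    using Suc by (auto intro!: euler_measurable)
  then show ?case
    using measurable_compose by force
qed

lemma emeasure_vimage_euler_iterate_le:
  assumes "0 \<le> s" "0 \<le> h" "h \<le> 1 / (8 * B * K\<^sub>0)" "s + real k * h \<le> T" "S \<in> sets borel"
  shows "emeasure lborel (euler_iterate s h k -` S)
     \<le> ennreal (exp (integral {s..s + real k * h} (\<lambda>t. 2 * delta f t) + real k * (K\<^sub>1 * h\<^sup>2))) * emeasure lborel S"
  using assms(4,5)
proof (induction k arbitrary: S)
  case 0
  then show ?case by simp
next
  case (Suc k)
  define a where "a = s + real k * h"
  define b where "b = s + real (Suc k) * h"
  have ab: "0 \<le> a" "a \<le> b" "b \<le> T" "b - a = h" "s \<le> a"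
    using assms(1,2) Suc.prems by (auto simp: a_def b_def algebra_simps)
  have "euler_iterate s h (Suc k) -` S = euler_iterate s h k -` (euler a b -` S)"
    by (auto simp: a_def b_def)
  moreover have "euler a b -` S \<in> sets borel"
    using measurable_sets_borel[OF euler_measurable[OF ab(1-3)] Suc.prems(2)] by simp
  ultimately have "emeasure lborel (euler_iterate s h (Suc k) -` S)
      \<le> ennreal (exp (integral {s..a} (\<lambda>t. 2 * delta f t) + real k * (K\<^sub>1 * h\<^sup>2))) * emeasure lborel (euler a b -` S)"
    using Suc.IH ab a_def by auto
  also have "\<dots> \<le> ennreal (exp (integral {s..a} (\<lambda>t. 2 * delta f t) + real k * (K\<^sub>1 * h\<^sup>2))) *
      (ennreal (exp (integral {a..b} (\<lambda>t. 2 * delta f t) + K\<^sub>1 * h\<^sup>2)) * emeasure lborel S)"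
    using emeasure_vimage_euler_le[OF ab(1-3) _ Suc.prems(2)] ab assms(3)
    by (intro mult_left_mono) auto
  also have "\<dots> = ennreal (exp (integral {s..a} (\<lambda>t. 2 * delta f t) + real k * (K\<^sub>1 * h\<^sup>2)) *
      exp (integral {a..b} (\<lambda>t. 2 * delta f t) + K\<^sub>1 * h\<^sup>2)) * emeasure lborel S"
    by (simp add: ennreal_mult mult.assoc)
  also have "exp (integral {s..a} (\<lambda>t. 2 * delta f t) + real k * (K\<^sub>1 * h\<^sup>2)) *
      exp (integral {a..b} (\<lambda>t. 2 * delta f t) + K\<^sub>1 * h\<^sup>2)
      = exp (integral {s..b} (\<lambda>t. 2 * delta f t) + real (Suc k) * (K\<^sub>1 * h\<^sup>2))"
    using Henstock_Kurzweil_Integration.integral_combine[OF ab(5,2), of "\<lambda>t. 2 * delta f t"]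
      integrable_on_mult_right[OF delta_integrable_sub[OF assms(1) ab(3)], of 2]
    by (simp add: exp_add[symmetric] algebra_simps)
  finally show ?case by (simp add: b_def)
qed

lemma ode_solution_has_integral:
  assumes y: "ode_solution f T x s y" and uv: "s \<le> u" "u \<le> v" "v \<le> T"
  shows "((\<lambda>t. f (y t) t) has_integral (y v - y u)) {u..v}"
proof -
  have "AE t in lebesgue. t \<in> {s..T} \<longrightarrow> (y has_vector_derivative f (y t) t) (at t within {s..T})"
    using y unfolding ode_solution_def by (subst (asm) AE_restrict_space_iff) auto
  then have "negligible {t. \<not> (t \<in> {s..T} \<longrightarrow> (y has_vector_derivative f (y t) t) (at t within {s..T}))}"
    by (simp add: completion.AE_iff_null_sets negligible_iff_null_sets)
  moreover have "abs_continuous_on {u..v} y"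
  proof -
    have "{u..v} \<subseteq> {s..T}" using uv by auto
    then show ?thesis
      using y unfolding ode_solution_def abs_continuous_on_def by (meson order_trans)
  qed
  ultimately show ?thesis
  proof (intro abs_continuous_on_has_integral[OF uv(2)])
    fix t assume "t \<in> {u..v} - {t. \<not> (t \<in> {s..T} \<longrightarrow> (y has_vector_derivative f (y t) t) (at t within {s..T}))}"
    then have "(y has_vector_derivative f (y t) t) (at t within {s..T})" using uv by auto
    then show "(y has_vector_derivative f (y t) t) (at t within {u..v})"
      by (rule has_vector_derivative_within_subset) (use uv in auto)
  qed
qed

lemma ode_solution_lipschitz:
  assumes y: "ode_solution f T x s y" and uv: "0 \<le> s" "s \<le> u" "u \<le> v" "v \<le> T"
  shows "norm (y v - y u) \<le> B * (v - u)"
proof -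
  note i = ode_solution_has_integral[OF y uv(2-4)]
  have "norm (integral {u..v} (\<lambda>t. f (y t) t)) \<le> B * (v - u)"
    by (rule integral_norm_bound_const[OF uv(3)]) (use i uv f_bound in auto)
  then show ?thesis using integral_unique[OF i] by simp
qed

text \<open>Both the Lipschitz error and the drift of the solution within one step are controlled; the bound holds for
  every sequence with \<open>e\<^sub>0 = 0\<close> and \<open>e\<^sub>k\<^sub>+\<^sub>1 \<le> (1 + B h) e\<^sub>k + (B h)\<^sup>2\<close>.\<close>

lemma euler_iterate_error:
  assumes y: "ode_solution f T x s y" and s: "0 \<le> s" "0 \<le> h" "s + real k * h \<le> T"
  shows "norm (y (s + real k * h) - euler_iterate s h k x) \<le> B * h * (exp (real k * (B * h)) - 1)"
  using s(3)
proof (induction k)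
  case 0
  then show ?case using y by (simp add: ode_solution_def)
next
  case (Suc k)
  define a where "a = s + real k * h"
  define b where "b = s + real (Suc k) * h"
  define X where "X = euler_iterate s h k x"
  define e where "e = norm (y a - X)"
  have ab: "0 \<le> a" "a \<le> b" "b \<le> T" "b - a = h" "s \<le> a"
    using s Suc.prems by (auto simp: a_def b_def algebra_simps)
  have IH: "e \<le> B * h * (exp (real k * (B * h)) - 1)"
    using Suc.IH ab by (simp add: a_def X_def e_def)
  note i = ode_solution_has_integral[OF y ab(5,2,3)]
  have "norm (integral {a..b} (\<lambda>t. f (y t) t - f X t)) \<le> B * (B * h + e) * (b - a)"
  proof (rule integral_norm_bound_const[OF ab(2)])
    show "(\<lambda>t. f (y t) t - f X t) integrable_on {a..b}"
      using i ab by (auto intro!: integrable_diff f_integrable_sub)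
    fix t assume t: "t \<in> {a..b}"
    have "norm (f (y t) t - f X t) \<le> B * norm (y t - X)" using t ab by (intro f_lipschitz) auto
    also have "norm (y t - X) \<le> norm (y t - y a) + e" 
      unfolding e_def using norm_triangle_ineq[of "y t - y a" "y a - X"] by simp
    also have "norm (y t - y a) \<le> B * (t - a)" using t ab s by (intro ode_solution_lipschitz[OF y]) auto
    also have "B * (t - a) \<le> B * h" using t ab B_ge_1 by (intro mult_left_mono) auto
    finally show "norm (f (y t) t - f X t) \<le> B * (B * h + e)" using B_ge_1 by simp
  qed
  also have "integral {a..b} (\<lambda>t. f (y t) t - f X t) = y b - y a - integral {a..b} (f X)"
    using i ab by (subst integral_diff) (auto intro!: f_integrable_sub simp: integral_unique[OF i])
  finally have "norm (y b - y a - integral {a..b} (f X)) \<le> B * (B * h + e) * h" using ab by simp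
  then have "norm (y b - euler a b X) \<le> e + B * (B * h + e) * h"
    unfolding e_def euler_def
    using norm_triangle_ineq[of "y a - X" "y b - y a - integral {a..b} (f X)"] by (simp add: algebra_simps)
  also have "\<dots> = (1 + B * h) * e + (B * h)\<^sup>2" by (simp add: power2_eq_square algebra_simps)
  also have "\<dots> \<le> (1 + B * h) * (B * h * (exp (real k * (B * h)) - 1)) + (B * h)\<^sup>2"
    using IH B_ge_1 s by (intro add_right_mono mult_left_mono) auto
  also have "\<dots> = B * h * ((1 + B * h) * exp (real k * (B * h)) - 1)"
    by (simp add: power2_eq_square algebra_simps)
  also have "\<dots> \<le> B * h * (exp (B * h) * exp (real k * (B * h)) - 1)"
    using B_ge_1 s exp_ge_add_one_self[of "B * h"]
    by (intro mult_left_mono diff_right_mono mult_right_mono) auto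
  also have "exp (B * h) * exp (real k * (B * h)) = exp (real (Suc k) * (B * h))"
    by (simp add: exp_add[symmetric] algebra_simps)
  finally show ?case by (simp add: a_def b_def X_def)
qed

text \<open>\<open>Suc N\<close> is the number of steps, which avoids division by zero.\<close>

lemma euler_iterate_tendsto:
  assumes y: "ode_solution f T x s y" and s: "0 \<le> s" "s \<le> t" "t \<le> T"
  shows "(\<lambda>N. euler_iterate s ((t - s) / real (Suc N)) (Suc N) x) \<longlonglongrightarrow> y t"
proof -
  let ?C = "B * (t - s) * (exp (B * (t - s)) - 1)"
  have "(\<lambda>N. euler_iterate s ((t - s) / real (Suc N)) (Suc N) x - y t) \<longlonglongrightarrow> 0"
  proof (rule Lim_null_comparison)
    show "(\<lambda>N. ?C * inverse (real (Suc N))) \<longlonglongrightarrow> 0"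
      using tendsto_mult_left[OF LIMSEQ_inverse_real_of_nat, of ?C] by simp
    show "\<forall>\<^sub>F N in sequentially. norm (euler_iterate s ((t - s) / real (Suc N)) (Suc N) x - y t)
        \<le> ?C * inverse (real (Suc N))"
    proof (intro always_eventually allI)
      fix N
      define h where "h = (t - s) / real (Suc N)"
      have h: "0 \<le> h" "real (Suc N) * h = t - s" using s by (simp_all add: h_def del: of_nat_Suc)
      have eq: "real (Suc N) * (B * h) = B * (t - s)" using h(2) by (metis mult.left_commute)
      have st: "s + real (Suc N) * h = t" using h(2) by simp
      have "norm (y t - euler_iterate s h (Suc N) x) \<le> B * h * (exp (B * (t - s)) - 1)"
        using euler_iterate_error[OF y s(1) h(1), of "Suc N"] s(3) unfolding eq st by blast
      also have "\<dots> = ?C * inverse (real (Suc N))" by (simp add: h_def divide_inverse)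
      finally show "norm (euler_iterate s ((t - s) / real (Suc N)) (Suc N) x - y t) \<le> ?C * inverse (real (Suc N))"
        by (simp add: h_def norm_minus_commute del: euler_iterate.simps of_nat_Suc)
    qed
  qed
  then show ?thesis by (rule LIM_zero_cancel)
qed

end

section \<open>Compression bound and measurability of the flow\<close>

text \<open>The time variable is rounded down to multiples of \<open>1 / (k + 1)\<close>; the rounded functions are
  measurable, being countable pastings of the measurable \<open>Y _ t\<close>.\<close>

lemma caratheodory_borel_measurable:
  fixes Y :: "'a::euclidean_space \<Rightarrow> real \<Rightarrow> 'b::euclidean_space"
  assumes meas: "\<And>t. (\<lambda>x. Y x t) \<in> borel_measurable borel" and cont: "\<And>x. continuous_on UNIV (Y x)"
  shows "(\<lambda>z. Y (fst z) (snd z)) \<in> borel_measurable borel"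
proof (rule borel_measurable_LIMSEQ_metric)
  let ?g = "\<lambda>k t. real_of_int \<lfloor>real (Suc k) * t\<rfloor> * inverse (real (Suc k))"
  have [measurable]: "fst \<in> borel_measurable (borel :: ('a \<times> real) measure)"
     "snd \<in> borel_measurable (borel :: ('a \<times> real) measure)"
    by (auto intro!: borel_measurable_continuous_onI continuous_intros)
  fix k
  show "(\<lambda>z. Y (fst z) (?g k (snd z))) \<in> borel_measurable borel"
  proof (rule measurable_compose_countable[where f = "\<lambda>i z. Y (fst z) (real_of_int i * inverse (real (Suc k)))"
        and g = "\<lambda>z. \<lfloor>real (Suc k) * snd z\<rfloor>"])
    show "(\<lambda>z. Y (fst z) (real_of_int i * inverse (real (Suc k)))) \<in> borel_measurable (borel :: ('a \<times> real) measure)" for i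
      by (rule measurable_compose[OF _ meas]) measurable
    show "(\<lambda>z. \<lfloor>real (Suc k) * snd z\<rfloor>) \<in> measurable (borel :: ('a \<times> real) measure) (count_space UNIV)"
      by measurable
  qed
next
  let ?g = "\<lambda>k t. real_of_int \<lfloor>real (Suc k) * t\<rfloor> * inverse (real (Suc k))"
  fix z :: "'a \<times> real"
  have "(\<lambda>k. ?g k (snd z)) \<longlonglongrightarrow> snd z"
  proof (rule LIM_zero_cancel, rule Lim_null_comparison[OF _ LIMSEQ_inverse_real_of_nat])
    show "\<forall>\<^sub>F k in sequentially. norm (?g k (snd z) - snd z) \<le> inverse (real (Suc k))"
    proof (intro always_eventually allI)
      fix k
      define m where "m = real (Suc k)"
      have m: "0 < m" by (simp add: m_def)
      have "?g k (snd z) - snd z = (real_of_int \<lfloor>m * snd z\<rfloor> - m * snd z) * inverse m"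
        unfolding m_def[symmetric] using m by (simp add: field_simps)
      moreover have "\<bar>real_of_int \<lfloor>m * snd z\<rfloor> - m * snd z\<bar> \<le> 1" by linarith
      ultimately show "norm (?g k (snd z) - snd z) \<le> inverse (real (Suc k))"
        unfolding m_def[symmetric] using m by (simp add: abs_mult mult_left_le_one_le)
    qed
  qed
  then show "(\<lambda>k. Y (fst z) (?g k (snd z))) \<longlonglongrightarrow> Y (fst z) (snd z)"
    by (rule continuous_on_tendsto_compose[OF cont]) auto
qed

context transport_field
begin

lemma flow_measurable:
  assumes y: "\<And>x. ode_solution f T x s (y x)" and s: "0 \<le> s" "s \<le> t" "t \<le> T"
  shows "(\<lambda>x. y x t) \<in> borel_measurable borel"
proof (rule borel_measurable_LIMSEQ_metric[OF _ euler_iterate_tendsto[OF y s]])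
  fix N
  have "real (Suc N) * ((t - s) / real (Suc N)) = t - s" by (simp del: of_nat_Suc)
  then show "euler_iterate s ((t - s) / real (Suc N)) (Suc N) \<in> borel_measurable borel"
    using s by (intro euler_iterate_measurable) auto
qed

lemma emeasure_vimage_flow_le:
  assumes y: "\<And>x. ode_solution f T x s (y x)" and s: "0 \<le> s" "s \<le> t" "t \<le> T"
    and S: "S \<in> sets borel"
  shows "emeasure lborel ((\<lambda>x. y x t) -` S)
     \<le> ennreal (exp (integral {s..t} (\<lambda>t. 2 * delta f t))) * emeasure lborel S"
proof (rule emeasure_vimage_limit_le[OF _ euler_iterate_tendsto[OF y s] _ _ exp_gt_zero S])
  let ?I = "integral {s..t} (\<lambda>t. 2 * delta f t)"
  let ?h = "\<lambda>N. (t - s) / real (Suc N)"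
  have h: "real (Suc N) * ?h N = t - s" "0 \<le> ?h N" for N using s by (simp_all del: of_nat_Suc)
  show "euler_iterate s (?h N) (Suc N) \<in> borel_measurable borel" for N
    using s h[of N] by (intro euler_iterate_measurable) auto
  have h0: "?h \<longlonglongrightarrow> 0"
    using tendsto_mult_left[OF LIMSEQ_inverse_real_of_nat, of "t - s"] by (simp add: divide_inverse)
  have "(\<lambda>N. exp (?I + K\<^sub>1 * (t - s) * ?h N)) \<longlonglongrightarrow> exp (?I + K\<^sub>1 * (t - s) * 0)"
    by (intro tendsto_intros h0)
  then show "(\<lambda>N. exp (?I + K\<^sub>1 * (t - s) * ?h N)) \<longlonglongrightarrow> exp ?I" by simp
  have "0 < 1 / (8 * B * K\<^sub>0)" using B_ge_1 K0_ge_1 by simp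
  from order_tendstoD(2)[OF h0 this]
  show "\<forall>\<^sub>F N in sequentially. \<forall>S\<in>sets borel. emeasure lborel (euler_iterate s (?h N) (Suc N) -` S)
      \<le> ennreal (exp (?I + K\<^sub>1 * (t - s) * ?h N)) * emeasure lborel S"
  proof (rule eventually_mono, intro ballI)
    fix N and S :: "(real ^ 'n) set" assume less: "?h N < 1 / (8 * B * K\<^sub>0)" and S: "S \<in> sets borel"
    have *: "s + real (Suc N) * ?h N = t" using h(1)[of N] by simp
    have "real (Suc N) * (K\<^sub>1 * (?h N)\<^sup>2) = K\<^sub>1 * (real (Suc N) * ?h N) * ?h N"
      by (simp add: power2_eq_square del: of_nat_Suc)
    then have **: "real (Suc N) * (K\<^sub>1 * (?h N)\<^sup>2) = K\<^sub>1 * (t - s) * ?h N" by (simp only: h(1))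
    from emeasure_vimage_euler_iterate_le[OF s(1) h(2) less_imp_le[OF less] _ S, of "Suc N"]
    show "emeasure lborel (euler_iterate s (?h N) (Suc N) -` S)
      \<le> ennreal (exp (?I + K\<^sub>1 * (t - s) * ?h N)) * emeasure lborel S"
      unfolding * ** using s by blast
  qed
qed

lemma growth_const_eq:
  assumes "0 \<le> s"
  shows "growth_const T f s = exp (integral {s..T} (delta f))"
proof -
  have "delta f absolutely_integrable_on {s..T}"
    using assms delta_bound delta_integrable_sub[OF assms]
    by (intro nonnegative_absolutely_integrable_1) auto
  then show ?thesis by (simp add: growth_const_def set_lebesgue_integral_eq_integral)
qed

lemma emeasure_vimage_flow_le_growth_const:
  assumes y: "\<And>x. ode_solution f T x s (y x)" and s: "0 \<le> s" "s \<le> t" "t \<le> T"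
    and S: "S \<in> sets borel"
  shows "emeasure lborel ((\<lambda>x. y x t) -` S) \<le> ennreal ((growth_const T f s)\<^sup>2) * emeasure lborel S"
proof -
  have "integral {s..t} (\<lambda>t. 2 * delta f t) = 2 * integral {s..t} (delta f)" by simp
  also have "\<dots> \<le> 2 * integral {s..T} (delta f)"
    using s delta_bound by (intro mult_left_mono integral_subset_le delta_integrable_sub) auto
  finally have "exp (integral {s..t} (\<lambda>t. 2 * delta f t)) \<le> (growth_const T f s)\<^sup>2"
    unfolding growth_const_eq[OF s(1)] by (simp add: exp_double[symmetric])
  then show ?thesis
    by (intro order_trans[OF emeasure_vimage_flow_le[OF y s S]] mult_right_mono ennreal_leI) auto
qed

text \<open>The time is clamped to \<open>[s, T]\<close> because a solution is unrestricted outside that interval.\<close>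

lemma flow_jointly_measurable:
  assumes y: "\<And>x. ode_solution f T x s (y x)" and s: "0 \<le> s" "s \<le> T"
  shows "(\<lambda>z. y (fst z) (max s (min T (snd z)))) \<in> borel_measurable borel"
proof (rule caratheodory_borel_measurable[of "\<lambda>x t. y x (max s (min T t))"])
  fix t
  show "(\<lambda>x. y x (max s (min T t))) \<in> borel_measurable borel"
    by (rule flow_measurable[OF y]) (use s in auto)
next
  fix x
  have *: "norm (y x v - y x u) \<le> B * \<bar>v - u\<bar>" if "u \<in> {s..T}" "v \<in> {s..T}" for u v
    using that s ode_solution_lipschitz[OF y, of u v x] ode_solution_lipschitz[OF y, of v u x]
    by (cases "u \<le> v") (auto simp: norm_minus_commute)
  have "continuous_on {s..T} (y x)"
    by (rule lipschitz_on_continuous_on[of B])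
      (use *[of v u for u v] B_ge_1 in \<open>auto simp: lipschitz_on_def dist_norm\<close>)
  then show "continuous_on UNIV (\<lambda>t. y x (max s (min T t)))"
    by (rule continuous_on_compose2) (use s in \<open>auto intro!: continuous_intros\<close>)
qed
end

section \<open>Minkowski's integral inequality\<close>

lemma ennreal_power2_le_imp_le:
  fixes a b :: ennreal
  assumes "a\<^sup>2 \<le> b\<^sup>2"
  shows "a \<le> b"
proof (cases b)
  case (real r)
  show ?thesis
  proof (cases a)
    case (real q)
    then show ?thesis
      using assms \<open>b = ennreal r\<close> \<open>0 \<le> r\<close> by (auto simp: ennreal_power intro: ennreal_leI power2_le_imp_le)
  next
    case top
    then show ?thesis using assms real by (simp add: ennreal_power top_unique)
  qed
qed simp

text \<open>Minkowski's integral inequality for the \<open>L\<^sub>2\<close> norm: expand the square of the inner integral as a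
  double integral, exchange the integrations, and apply Cauchy-Schwarz for each pair of times. \<open>N\<close> is any measurable
  bound for the norms of the slices.\<close>

lemma nn_integral_minkowski:
  fixes W :: "'a::euclidean_space \<times> real \<Rightarrow> ennreal" and N :: "real \<Rightarrow> ennreal"
  assumes W: "W \<in> borel_measurable borel" and N[measurable]: "N \<in> borel_measurable borel"
    and le: "AE t in lborel. (\<integral>\<^sup>+x. (W (x, t))\<^sup>2 \<partial>lborel) \<le> (N t)\<^sup>2"
  shows "(\<integral>\<^sup>+x. (\<integral>\<^sup>+t. W (x, t) \<partial>lborel)\<^sup>2 \<partial>lborel) \<le> (\<integral>\<^sup>+t. N t \<partial>lborel)\<^sup>2"
proof -
  have [measurable]: "W \<in> borel_measurable (borel \<Otimes>\<^sub>M borel)" using W by (simp add: borel_prod)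
  have "(\<integral>\<^sup>+x. (\<integral>\<^sup>+t. W (x, t) \<partial>lborel)\<^sup>2 \<partial>lborel)
     = (\<integral>\<^sup>+x. (\<integral>\<^sup>+t. \<integral>\<^sup>+r. W (x, t) * W (x, r) \<partial>lborel \<partial>lborel) \<partial>lborel)"
    by (simp add: power2_eq_square nn_integral_cmult nn_integral_multc)
  also have "\<dots> = (\<integral>\<^sup>+t. (\<integral>\<^sup>+x. \<integral>\<^sup>+r. W (x, t) * W (x, r) \<partial>lborel \<partial>lborel) \<partial>lborel)"
    by (rule lborel_pair.Fubini'[symmetric]) measurable
  also have "\<dots> = (\<integral>\<^sup>+t. (\<integral>\<^sup>+r. \<integral>\<^sup>+x. W (x, t) * W (x, r) \<partial>lborel \<partial>lborel) \<partial>lborel)"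
    by (intro nn_integral_cong lborel_pair.Fubini'[symmetric]) measurable
  also have "\<dots> \<le> (\<integral>\<^sup>+t. (\<integral>\<^sup>+r. N t * N r \<partial>lborel) \<partial>lborel)"
  proof (rule nn_integral_mono_AE)
    from le show "AE t in lborel. (\<integral>\<^sup>+r. \<integral>\<^sup>+x. W (x, t) * W (x, r) \<partial>lborel \<partial>lborel)
        \<le> (\<integral>\<^sup>+r. N t * N r \<partial>lborel)"
    proof (rule eventually_mono)
      fix t assume t: "(\<integral>\<^sup>+x. (W (x, t))\<^sup>2 \<partial>lborel) \<le> (N t)\<^sup>2"
      show "(\<integral>\<^sup>+r. \<integral>\<^sup>+x. W (x, t) * W (x, r) \<partial>lborel \<partial>lborel) \<le> (\<integral>\<^sup>+r. N t * N r \<partial>lborel)"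
      proof (rule nn_integral_mono_AE)
        from le show "AE r in lborel. (\<integral>\<^sup>+x. W (x, t) * W (x, r) \<partial>lborel) \<le> N t * N r"
        proof (rule eventually_mono)
          fix r assume r: "(\<integral>\<^sup>+x. (W (x, r))\<^sup>2 \<partial>lborel) \<le> (N r)\<^sup>2"
          have "(\<integral>\<^sup>+x. W (x, t) * W (x, r) \<partial>lborel)\<^sup>2
             \<le> (\<integral>\<^sup>+x. (W (x, t))\<^sup>2 \<partial>lborel) * (\<integral>\<^sup>+x. (W (x, r))\<^sup>2 \<partial>lborel)"
            by (rule Cauchy_Schwarz_nn_integral) measurable
          also have "\<dots> \<le> (N t)\<^sup>2 * (N r)\<^sup>2" by (rule mult_mono[OF t r]) auto
          also have "\<dots> = (N t * N r)\<^sup>2" by (simp add: power_mult_distrib)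
          finally show "(\<integral>\<^sup>+x. W (x, t) * W (x, r) \<partial>lborel) \<le> N t * N r"
            by (rule ennreal_power2_le_imp_le)
        qed
      qed
    qed
  qed
  also have "\<dots> = (\<integral>\<^sup>+t. N t \<partial>lborel)\<^sup>2"
    by (simp add: power2_eq_square nn_integral_cmult nn_integral_multc)
  finally show ?thesis .
qed

section \<open>Integrals along the flow\<close>

lemma AE_lborel_commute:
  fixes N :: "('a::euclidean_space \<times> 'b::euclidean_space) set"
  assumes "N \<in> sets borel"
  shows "(AE x in lborel. AE t in lborel. (x, t) \<notin> N) \<longleftrightarrow> (AE t in lborel. AE x in lborel. (x, t) \<notin> N)"
proof (rule lborel_pair.AE_commute)
  have [measurable]: "N \<in> sets (borel \<Otimes>\<^sub>M borel)" using assms unfolding borel_prod .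
  show "{x \<in> space (lborel \<Otimes>\<^sub>M lborel). (fst x, snd x) \<notin> N} \<in> sets (lborel \<Otimes>\<^sub>M lborel)"
    by measurable
qed

lemma AE_lborel_pair_swap:
  fixes P :: "'a::euclidean_space \<times> 'b::euclidean_space \<Rightarrow> bool"
  assumes "AE z in lborel. P z"
  shows "AE t in lborel. AE x in lborel. P (x, t)"
proof -
  obtain N where N: "{z. \<not> P z} \<subseteq> N" "N \<in> null_sets lborel"
    using assms by (auto simp: eventually_ae_filter)
  have "AE z in lborel. (fst z, snd z) \<notin> N" using AE_not_in[OF N(2)] by simp
  then have "AE x in lborel. AE t in lborel. (x, t) \<notin> N"
    by (rule AE_lborel_pair[of "\<lambda>x t. (x, t) \<notin> N"])
  then have "AE t in lborel. AE x in lborel. (x, t) \<notin> N"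
    using N(2) AE_lborel_commute[of N] by (simp add: null_sets_def)
  then show ?thesis using N(1) by (auto elim!: eventually_mono)
qed

text \<open>Null sets pull back to null sets under \<open>(x, t) \<mapsto> (Y x t, t)\<close>. This is what makes the
  composition of a merely Lebesgue measurable function with the flow well defined almost everywhere.\<close>

lemma AE_transport:
  fixes Y :: "'a::euclidean_space \<Rightarrow> real \<Rightarrow> 'a"
  assumes Y[measurable]: "(\<lambda>z. Y (fst z) (snd z)) \<in> borel_measurable borel"
    and push: "\<And>t S. t \<in> A \<Longrightarrow> S \<in> sets borel \<Longrightarrow>
         emeasure lborel ((\<lambda>x. Y x t) -` S) \<le> ennreal C * emeasure lborel S"
    and A[measurable]: "A \<in> sets borel"
    and P: "AE z in lborel. P z"
  shows "AE x in lborel. AE t in lborel. t \<in> A \<longrightarrow> P (Y x t, t)"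
proof -
  obtain N where N: "{z. \<not> P z} \<subseteq> N" "N \<in> null_sets lborel"
    using P by (auto simp: eventually_ae_filter)
  have Nb[measurable]: "N \<in> sets borel" using N(2) by (simp add: null_sets_def)
  have snd_meas[measurable]: "snd \<in> borel_measurable (borel :: ('a \<times> real) measure)"
    by (auto intro!: borel_measurable_continuous_onI continuous_intros)
  have Yb: "(\<lambda>x. Y x t) \<in> borel_measurable borel" for t
  proof -
    have "(\<lambda>x. (x, t)) \<in> borel_measurable (borel :: 'a measure)"
      by (auto intro!: borel_measurable_continuous_onI continuous_intros)
    from measurable_compose[OF this Y] show ?thesis by simp
  qed
  define M where "M = {z. snd z \<in> A \<and> (Y (fst z) (snd z), snd z) \<in> N}"
  have "(\<lambda>z. (Y (fst z) (snd z), snd z)) \<in> borel_measurable borel"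
    by (rule borel_measurable_Pair) measurable
  from measurable_sets_borel[OF this Nb]
  have "(\<lambda>z. (Y (fst z) (snd z), snd z)) -` N \<in> sets borel" by simp
  moreover have "snd -` A \<in> sets (borel :: ('a \<times> real) measure)"
    using measurable_sets_borel[OF snd_meas A] by simp
  ultimately have "snd -` A \<inter> (\<lambda>z. (Y (fst z) (snd z), snd z)) -` N \<in> sets borel" by (rule sets.Int[rotated])
  also have "snd -` A \<inter> (\<lambda>z. (Y (fst z) (snd z), snd z)) -` N = M" by (auto simp: M_def)
  finally have Mb: "M \<in> sets borel" .
  have "AE t in lborel. AE x in lborel. (x, t) \<notin> N"
    by (rule AE_lborel_pair_swap[OF AE_not_in[OF N(2)]])
  then have "AE t in lborel. AE x in lborel. (x, t) \<notin> M"
  proof (rule eventually_mono)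
    fix t assume t: "AE x in lborel. (x, t) \<notin> N"
    show "AE x in lborel. (x, t) \<notin> M"
    proof (cases "t \<in> A")
      case True
      have "(\<lambda>x. (x, t)) \<in> borel_measurable (borel :: 'a measure)"
        by (auto intro!: borel_measurable_continuous_onI continuous_intros)
      from measurable_sets_borel[OF this Nb] have Sb: "{x. (x, t) \<in> N} \<in> sets borel"
        by (simp add: vimage_def)
      have "{x. (x, t) \<in> N} \<in> null_sets lborel"
        using AE_iff_null[of lborel "\<lambda>x. (x, t) \<notin> N"] t Sb by simp
      then have "emeasure lborel {x. (x, t) \<in> N} = 0" by auto
      then have "emeasure lborel ((\<lambda>x. Y x t) -` {x. (x, t) \<in> N}) = 0"
        using push[OF True Sb] by simp
      moreover have "(\<lambda>x. Y x t) -` {x. (x, t) \<in> N} \<in> sets borel"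
        using measurable_sets_borel[OF Yb Sb] by simp
      ultimately have "(\<lambda>x. Y x t) -` {x. (x, t) \<in> N} \<in> null_sets lborel" by (simp add: null_sets_def)
      from AE_not_in[OF this] show ?thesis by (rule eventually_mono) (simp add: M_def)
    qed (simp add: M_def)
  qed
  then have "AE x in lborel. AE t in lborel. (x, t) \<notin> M"
    using AE_lborel_commute[OF Mb] by simp
  then show ?thesis using N(1) by (auto elim!: eventually_mono simp: M_def)
qed

lemma transported_integral_L2_bound:
  fixes \<phi> :: "real ^ 'n::finite \<Rightarrow> real \<Rightarrow> real" and Y :: "real ^ 'n \<Rightarrow> real \<Rightarrow> real ^ 'n"
  assumes \<phi>: "in_L1_L2 T \<phi>" and s: "0 \<le> s" "s \<le> T" and c: "0 < c"
    and Y: "(\<lambda>z. Y (fst z) (snd z)) \<in> borel_measurable borel"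
    and push: "\<And>t S. t \<in> {s..T} \<Longrightarrow> S \<in> sets borel \<Longrightarrow>
         emeasure lborel ((\<lambda>x. Y x t) -` S) \<le> ennreal (c\<^sup>2) * emeasure lborel S"
  shows "AE x in lebesgue. set_integrable lebesgue {s..T} (\<lambda>t. \<phi> (Y x t) t)"
    and "in_L2 (\<lambda>x. LINT t:{s..T}|lebesgue. \<phi> (Y x t) t)"
    and "L2_norm (\<lambda>x. LINT t:{s..T}|lebesgue. \<phi> (Y x t) t)
           \<le> c * (LINT t:{s..T}|lebesgue. L2_norm (\<lambda>x. \<phi> x t))"
proof -
  obtain \<phi>' where \<phi>'b: "\<phi>' \<in> borel_measurable borel"
    and "AE z in lborel. (if snd z \<in> {0..T} then \<phi> (fst z) (snd z) else 0) = \<phi>' z"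
    using meas_strip_borel_representative \<phi> unfolding in_L1_L2_def by blast
  then have \<phi>': "AE z in lborel. snd z \<in> {s..T} \<longrightarrow> \<phi>' z = \<phi> (fst z) (snd z)"
    using s by (auto elim!: eventually_mono)
  have [measurable]: "\<phi>' \<in> borel_measurable (borel \<Otimes>\<^sub>M borel)" using \<phi>'b by (simp add: borel_prod)
  have [measurable]: "(\<lambda>z. Y (fst z) (snd z)) \<in> borel_measurable (borel \<Otimes>\<^sub>M borel)" using Y by (simp add: borel_prod)
  have [measurable]: "(\<lambda>x. Y x t) \<in> borel_measurable borel" for t
  proof -
    have "(\<lambda>x. (x, t)) \<in> measurable borel (borel \<Otimes>\<^sub>M borel)" by measurable
    from measurable_compose[OF this \<open>(\<lambda>z. Y (fst z) (snd z)) \<in> borel_measurable (borel \<Otimes>\<^sub>M borel)\<close>]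
    show ?thesis by simp
  qed
  define W where "W z = indicator {s..T} (snd z) * \<phi>' (Y (fst z) (snd z), snd z)" for z :: "(real ^ 'n) \<times> real"
  have W_meas[measurable]: "W \<in> borel_measurable (borel \<Otimes>\<^sub>M borel)"
    unfolding W_def by measurable
  \<comment> \<open>\<open>W\<close> is a Borel version of the integrand, so that Tonelli and Minkowski apply to it\<close>
  have WV: "AE x in lborel. AE t in lborel. W (x, t) = indicator {s..T} t *\<^sub>R \<phi> (Y x t) t"
  proof -
    have "AE x in lborel. AE t in lborel. t \<in> {s..T} \<longrightarrow> snd (Y x t, t) \<in> {s..T} \<longrightarrow>
        \<phi>' (Y x t, t) = \<phi> (fst (Y x t, t)) (snd (Y x t, t))"
      by (rule AE_transport[OF Y push _ \<phi>']) auto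
    then show ?thesis
      by (rule eventually_mono) (auto elim!: eventually_mono simp: W_def indicator_def)
  qed
  \<comment> \<open>\<open>N t\<close> is a Borel version of \<open>c\<close> times the \<open>L\<^sub>2\<close> norm of the slice of \<open>\<phi>\<close> at time \<open>t\<close>\<close>
  define N where "N t = ennreal (c * sqrt (enn2real (\<integral>\<^sup>+x. ennreal (\<bar>\<phi>' (x, t)\<bar>\<^sup>2) \<partial>lborel))) * indicator {s..T} t" for t
  have N_meas[measurable]: "N \<in> borel_measurable borel" unfolding N_def by measurable
  have sl: "AE t in lborel. t \<in> {s..T} \<longrightarrow> in_L2 (\<lambda>x. \<phi> x t) \<and> (AE x in lborel. \<phi>' (x, t) = \<phi> x t)"
  proof -
    have "AE t in lebesgue. t \<in> {0..T} \<longrightarrow> in_L2 (\<lambda>x. \<phi> x t)"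
      using \<phi> unfolding in_L1_L2_def by (subst (asm) AE_restrict_space_iff) auto
    then have "AE t in lborel. t \<in> {0..T} \<longrightarrow> in_L2 (\<lambda>x. \<phi> x t)" by (simp add: AE_completion_iff)
    with AE_lborel_pair_swap[OF \<phi>'] show ?thesis
      by eventually_elim (use s in \<open>auto elim: eventually_mono\<close>)
  qed
  have slice: "AE t in lborel. t \<in> {s..T} \<longrightarrow>
     (\<integral>\<^sup>+x. ennreal (\<bar>\<phi>' (x, t)\<bar>\<^sup>2) \<partial>lborel) = ennreal ((L2_norm (\<lambda>x. \<phi> x t))\<^sup>2)"
    using sl
  proof (rule eventually_mono, intro impI)
    fix t assume *: "t \<in> {s..T} \<longrightarrow> in_L2 (\<lambda>x. \<phi> x t) \<and> (AE x in lborel. \<phi>' (x, t) = \<phi> x t)" "t \<in> {s..T}"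
    then have L2: "in_L2 (\<lambda>x. \<phi> x t)" and ae: "AE x in lborel. \<phi>' (x, t) = \<phi> x t" by auto
    have "(\<integral>\<^sup>+x. ennreal (\<bar>\<phi>' (x, t)\<bar>\<^sup>2) \<partial>lborel) = (\<integral>\<^sup>+x. ennreal (\<bar>\<phi>' (x, t)\<bar>\<^sup>2) \<partial>lebesgue)"
      by (simp add: nn_integral_completion)
    also have "\<dots> = (\<integral>\<^sup>+x. ennreal (\<bar>\<phi> x t\<bar>\<^sup>2) \<partial>lebesgue)"
      by (rule nn_integral_cong_AE) (use AE_completion[OF ae] in \<open>auto elim: eventually_mono\<close>)
    also have "\<dots> = ennreal (LINT x|lebesgue. \<bar>\<phi> x t\<bar>\<^sup>2)"
      by (rule nn_integral_eq_integral) (use L2 in \<open>auto simp: in_L2_def\<close>)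
    finally show "(\<integral>\<^sup>+x. ennreal (\<bar>\<phi>' (x, t)\<bar>\<^sup>2) \<partial>lborel) = ennreal ((L2_norm (\<lambda>x. \<phi> x t))\<^sup>2)"
      by (simp add: L2_norm_def)
  qed
  have L2_nonneg: "0 \<le> L2_norm g" for g :: "real ^ 'n \<Rightarrow> real" by (simp add: L2_norm_def)
  have NL: "AE t in lborel. N t = ennreal (indicator {s..T} t *\<^sub>R (c * L2_norm (\<lambda>x. \<phi> x t)))"
    using slice by (rule eventually_mono) (auto simp: N_def indicator_def L2_nonneg)
  have WN: "AE t in lborel. (\<integral>\<^sup>+x. (ennreal \<bar>W (x, t)\<bar>)\<^sup>2 \<partial>lborel) \<le> (N t)\<^sup>2"
    using slice
  proof (rule eventually_mono)
    fix t assume sl: "t \<in> {s..T} \<longrightarrow>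
       (\<integral>\<^sup>+x. ennreal (\<bar>\<phi>' (x, t)\<bar>\<^sup>2) \<partial>lborel) = ennreal ((L2_norm (\<lambda>x. \<phi> x t))\<^sup>2)"
    show "(\<integral>\<^sup>+x. (ennreal \<bar>W (x, t)\<bar>)\<^sup>2 \<partial>lborel) \<le> (N t)\<^sup>2"
    proof (cases "t \<in> {s..T}")
      case True
      have "(\<integral>\<^sup>+x. (ennreal \<bar>W (x, t)\<bar>)\<^sup>2 \<partial>lborel) = (\<integral>\<^sup>+x. ennreal (\<bar>\<phi>' (Y x t, t)\<bar>\<^sup>2) \<partial>lborel)"
        using True by (simp add: W_def ennreal_power)
      also have "\<dots> \<le> ennreal (c\<^sup>2) * (\<integral>\<^sup>+x. ennreal (\<bar>\<phi>' (x, t)\<bar>\<^sup>2) \<partial>lborel)"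
        using push[OF True] by (intro nn_integral_vimage_le) auto
      also have "\<dots> = (N t)\<^sup>2"
        using True sl c L2_nonneg
        by (simp add: N_def ennreal_power power_mult_distrib ennreal_mult'[symmetric])
      finally show ?thesis .
    qed (simp add: W_def)
  qed
  define R where "R = (LINT t:{s..T}|lebesgue. L2_norm (\<lambda>x. \<phi> x t))"
  have Rint: "set_integrable lebesgue {s..T} (\<lambda>t. L2_norm (\<lambda>x. \<phi> x t))"
    using \<phi> s unfolding in_L1_L2_def by (auto intro: set_integrable_subset)
  have R0: "0 \<le> R" unfolding R_def set_lebesgue_integral_def
    by (intro integral_nonneg_AE) (auto simp: L2_nonneg)
  have Nint: "(\<integral>\<^sup>+t. N t \<partial>lborel) = ennreal (c * R)"
  proof -
    have "(\<integral>\<^sup>+t. N t \<partial>lborel) = (\<integral>\<^sup>+t. N t \<partial>lebesgue)" by (simp add: nn_integral_completion)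
    also have "\<dots> = (\<integral>\<^sup>+t. ennreal (indicator {s..T} t *\<^sub>R (c * L2_norm (\<lambda>x. \<phi> x t))) \<partial>lebesgue)"
      by (rule nn_integral_cong_AE[OF AE_completion[OF NL]])
    also have "\<dots> = ennreal (LINT t:{s..T}|lebesgue. c * L2_norm (\<lambda>x. \<phi> x t))"
      unfolding set_lebesgue_integral_def
      using set_integrable_mult_right[of c, OF Rint] c L2_nonneg unfolding set_integrable_def
      by (intro nn_integral_eq_integral) auto
    also have "\<dots> = ennreal (c * R)" by (simp add: R_def)
    finally show ?thesis .
  qed
  have main: "(\<integral>\<^sup>+x. (\<integral>\<^sup>+t. ennreal \<bar>W (x, t)\<bar> \<partial>lborel)\<^sup>2 \<partial>lborel) \<le> ennreal ((c * R)\<^sup>2)"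
  proof -
    have "(\<lambda>z. ennreal \<bar>W z\<bar>) \<in> borel_measurable borel" using W_meas unfolding borel_prod by measurable
    from nn_integral_minkowski[OF this N_meas WN] show ?thesis
      unfolding Nint using c R0 by (simp add: ennreal_power)
  qed
  have Wx: "(\<lambda>t. W (x, t)) \<in> borel_measurable borel" for x by measurable
  have Wfin: "AE x in lborel. integrable lborel (\<lambda>t. W (x, t))"
  proof -
    have "AE x in lborel. (\<integral>\<^sup>+t. ennreal \<bar>W (x, t)\<bar> \<partial>lborel)\<^sup>2 \<noteq> \<infinity>"
      by (rule nn_integral_PInf_AE) (use main in \<open>auto simp: top_unique\<close>)
    then show ?thesis
      by (rule eventually_mono) (auto simp: integrable_iff_bounded Wx less_top power2_eq_square ennreal_mult_eq_top_iff)
  qed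
  define V where "V x = (LINT t:{s..T}|lebesgue. \<phi> (Y x t) t)" for x
  define U where "U x = (LINT t|lborel. W (x, t))" for x
  have U_meas[measurable]: "U \<in> borel_measurable borel" unfolding U_def by measurable
  have VU: "AE x in lborel. set_integrable lebesgue {s..T} (\<lambda>t. \<phi> (Y x t) t) \<and> U x = V x"
    using Wfin WV
  proof eventually_elim
    case (elim x)
    have ae: "AE t in lebesgue. W (x, t) = indicator {s..T} t *\<^sub>R \<phi> (Y x t) t"
      using AE_completion[OF elim(2)] .
    have WL: "(\<lambda>t. W (x, t)) \<in> borel_measurable lebesgue" using Wx by (intro measurable_completion) simp
    have \<phi>L: "(\<lambda>t. indicator {s..T} t *\<^sub>R \<phi> (Y x t) t) \<in> borel_measurable lebesgue"
      by (rule borel_measurable_AE[OF WL ae])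
    have "integrable lebesgue (\<lambda>t. W (x, t))"
      using elim(1) Wx by (subst integrable_completion) auto
    then have "integrable lebesgue (\<lambda>t. indicator {s..T} t *\<^sub>R \<phi> (Y x t) t)"
      using integrable_cong_AE[OF WL \<phi>L ae] by simp
    moreover have "U x = (LINT t|lebesgue. W (x, t))"
      unfolding U_def using Wx by (subst integral_completion) auto
    moreover have "\<dots> = V x" unfolding V_def set_lebesgue_integral_def
      by (rule integral_cong_AE[OF WL \<phi>L ae])
    ultimately show ?case by (simp add: set_integrable_def)
  qed
  from AE_completion[OF VU]
  show "AE x in lebesgue. set_integrable lebesgue {s..T} (\<lambda>t. \<phi> (Y x t) t)"
    by (auto elim: eventually_mono)
  have VUl: "AE x in lebesgue. U x = V x"
    using AE_completion[OF VU] by (auto elim: eventually_mono)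
  have UL: "U \<in> borel_measurable lebesgue" using U_meas by (intro measurable_completion) simp
  have VL: "V \<in> borel_measurable lebesgue" by (rule borel_measurable_AE[OF UL VUl])
  have "(\<integral>\<^sup>+x. ennreal (\<bar>V x\<bar>\<^sup>2) \<partial>lebesgue) = (\<integral>\<^sup>+x. ennreal (\<bar>U x\<bar>\<^sup>2) \<partial>lebesgue)"
    by (rule nn_integral_cong_AE) (use VUl in \<open>auto elim: eventually_mono\<close>)
  also have "\<dots> = (\<integral>\<^sup>+x. ennreal (\<bar>U x\<bar>\<^sup>2) \<partial>lborel)" by (simp add: nn_integral_completion)
  also have "\<dots> \<le> (\<integral>\<^sup>+x. (\<integral>\<^sup>+t. ennreal \<bar>W (x, t)\<bar> \<partial>lborel)\<^sup>2 \<partial>lborel)"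
  proof (rule nn_integral_mono_AE, use Wfin in \<open>rule eventually_mono\<close>)
    fix x assume "integrable lborel (\<lambda>t. W (x, t))"
    from integral_norm_bound_ennreal[OF this]
    have "ennreal \<bar>U x\<bar> \<le> (\<integral>\<^sup>+t. ennreal \<bar>W (x, t)\<bar> \<partial>lborel)" by (simp add: U_def)
    then show "ennreal (\<bar>U x\<bar>\<^sup>2) \<le> (\<integral>\<^sup>+t. ennreal \<bar>W (x, t)\<bar> \<partial>lborel)\<^sup>2"
      by (subst ennreal_power[symmetric]) (auto intro: power_mono)
  qed
  finally have V2: "(\<integral>\<^sup>+x. ennreal (\<bar>V x\<bar>\<^sup>2) \<partial>lebesgue) \<le> ennreal ((c * R)\<^sup>2)" using main by (rule order_trans)
  have Vint: "integrable lebesgue (\<lambda>x. \<bar>V x\<bar>\<^sup>2)"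
  proof (rule integrableI_bounded)
    show "(\<lambda>x. \<bar>V x\<bar>\<^sup>2) \<in> borel_measurable lebesgue" using VL by measurable
    show "(\<integral>\<^sup>+x. ennreal (norm (\<bar>V x\<bar>\<^sup>2)) \<partial>lebesgue) < \<infinity>"
      using V2 by (simp add: le_less_trans)
  qed
  then show "in_L2 (\<lambda>x. LINT t:{s..T}|lebesgue. \<phi> (Y x t) t)"
    using VL unfolding in_L2_def V_def by blast
  have "ennreal (LINT x|lebesgue. \<bar>V x\<bar>\<^sup>2) \<le> ennreal ((c * R)\<^sup>2)"
    using V2 nn_integral_eq_integral[OF Vint] by simp
  then have "(LINT x|lebesgue. \<bar>V x\<bar>\<^sup>2) \<le> (c * R)\<^sup>2" by (simp add: ennreal_le_iff)
  then have "sqrt (LINT x|lebesgue. \<bar>V x\<bar>\<^sup>2) \<le> c * R"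
    using c R0 by (intro real_le_lsqrt) auto
  then show "L2_norm (\<lambda>x. LINT t:{s..T}|lebesgue. \<phi> (Y x t) t)
           \<le> c * (LINT t:{s..T}|lebesgue. L2_norm (\<lambda>x. \<phi> x t))"
    unfolding L2_norm_def R_def V_def .
qed

theorem mainTheorem2:
  fixes T :: real
    and f :: "real ^ 'n::finite \<Rightarrow> real \<Rightarrow> real ^ 'n"
    and y :: "real ^ 'n \<Rightarrow> real \<Rightarrow> real \<Rightarrow> real ^ 'n"
    and \<phi> :: "real ^ 'n \<Rightarrow> real \<Rightarrow> real"
  assumes "T > 0"
    and "regular_field T f"
    and "\<And>x s. s \<in> {0..T} \<Longrightarrow> ode_solution f T x s (y x s)"
    and "in_L1_L2 T \<phi>"
  shows "\<forall>s\<in>{0..T}.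
      (AE x in lebesgue. set_integrable lebesgue {s..T} (\<lambda>t. \<phi> (y x s t) t)) \<and>
      in_L2 (\<lambda>x. path_integral T \<phi> y x s) \<and>
      L2_norm (\<lambda>x. path_integral T \<phi> y x s)
        \<le> growth_const T f s * (LINT t:{s..T}|lebesgue. L2_norm (\<lambda>x. \<phi> x t))"
proof
  fix s assume s: "s \<in> {0..T}"
  obtain B where "transport_field T f B"
    using regular_field_imp_transport_field[OF assms(2)] by blast
  then interpret transport_field T f B .
  have sol: "ode_solution f T x s (y x s)" for x using assms(3) s by blast
  \<comment> \<open>outside \<open>[s, T]\<close> the time is clamped, since nothing is known about the solutions there\<close>
  define Y where "Y x t = y x s (max s (min T t))" for x t
  have Yy: "Y x t = y x s t" if "t \<in> {s..T}" for x t using that by (simp add: Y_def)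
  have meas: "(\<lambda>z. Y (fst z) (snd z)) \<in> borel_measurable borel"
    unfolding Y_def using flow_jointly_measurable[OF sol] s by auto
  have push: "emeasure lborel ((\<lambda>x. Y x t) -` S) \<le> ennreal ((growth_const T f s)\<^sup>2) * emeasure lborel S"
    if "t \<in> {s..T}" "S \<in> sets borel" for t S
    using emeasure_vimage_flow_le_growth_const[OF sol, of t S] that s by (simp add: Yy)
  have c: "0 < growth_const T f s" by (simp add: growth_const_def)
  have s': "0 \<le> s" "s \<le> T" using s by auto
  note * = transported_integral_L2_bound[OF assms(4) s' c meas push]
  have 1: "set_integrable lebesgue {s..T} (\<lambda>t. \<phi> (Y x t) t) = set_integrable lebesgue {s..T} (\<lambda>t. \<phi> (y x s t) t)" for x
    by (rule set_integrable_cong) (auto simp: Yy)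
  have 2: "(LINT t:{s..T}|lebesgue. \<phi> (Y x t) t) = path_integral T \<phi> y x s" for x
    unfolding path_integral_def by (rule set_lebesgue_integral_cong) (auto simp: Yy)
  show "(AE x in lebesgue. set_integrable lebesgue {s..T} (\<lambda>t. \<phi> (y x s t) t)) \<and>
      in_L2 (\<lambda>x. path_integral T \<phi> y x s) \<and>
      L2_norm (\<lambda>x. path_integral T \<phi> y x s)
        \<le> growth_const T f s * (LINT t:{s..T}|lebesgue. L2_norm (\<lambda>x. \<phi> x t))"
    using * unfolding 1 2 by blast
qed

end
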